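(* Let $K$ be a complete non-Archimedean field and $r\ge 0$. The tropicalization maps $\pi_\iota\colon\overline{\mathcal X}_r(K)\to\operatorname{Trop}(\mathbb P^r,\iota)$ induce a natural homeomorphism $$\overline{\mathcal X}_r(K)\xrightarrow{\ \sim\ }\varprojlim_{\iota\in I}\operatorname{Trop}(\mathbb P^r,\iota),\qquad x\longmapsto(\pi_\iota(x))_{\iota\in I},$$ where the projective limit is taken over the category $I$ of linear closed immersions of $\mathbb P^r$ into torus-invariant open subsets of projective spaces.
   Context: $K$ is a field complete with respect to a non-Archimedean absolute value $|\cdot|$ (possibly trivial). A seminorm on a finite-dimensional $K$-vector space $W$ is a map $\|\cdot\|\colon W\to\mathbb R$ with $\|w\|\ge 0$, $\|\lambda w\|=|\lambda|\,\|w\|$ and $\|w+w'\|\le\max\{\|w\|,\|w'\|\}$; it is non-trivial if it is not identically $0$. $\overline{\mathcal X}_r(K)$ is the set of non-trivial seminorms on the dual space $(K^{r+1})^*$ modulo homothety ($\|\cdot\|\sim c\|\cdot\|$, $c>0$), with the quotient topology of the coarsest topology on the set of non-trivial seminorms making all evaluations $\|\cdot\|\mapsto\|f\|$, $f\in(K^{r+1})^*$, continuous. For a class $x$, write $\|\cdot\|_x$ for a representative. $\overline{\mathbb R}=\mathbb R\cup\{\infty\}$ with its usual topology, $-\log 0=\infty$, and $\mathbb T\mathbb P^n=(\overline{\mathbb R}^{n+1}\setminus\{(\infty,\dots,\infty)\})/\mathbb R\cdot(1,\dots,1)$ with the quotient topology. Category $I$: objects are linear closed immersions $\iota\colon\mathbb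 P^r\hookrightarrow U\subseteq\mathbb P^n$ over $K$ ($n$ arbitrary), where $U$ is a torus-invariant open subset of $\mathbb P^n$; so $\iota=[f_0:\dots:f_n]$ with $f_0,\dots,f_n$ spanning $(K^{r+1})^*$. A morphism from $\iota\colon\mathbb P^r\hookrightarrow U\subseteq\mathbb P^n$ to $\iota'\colon\mathbb P^r\hookrightarrow U'\subseteq\mathbb P^{n'}$ is a linear toric morphism $\varphi\colon U\to U'$ (a morphism given by linear forms that restricts to a homomorphism of the big tori, i.e. of the form $[x_0:\dots:x_n]\mapsto[x_{\sigma(0)}:\dots:x_{\sigma(n')}]$) with $\varphi\circ\iota=\iota'$. $\operatorname{Trop}(\mathbb P^r,\iota)\subseteq\mathbb T\mathbb P^n$ (with the subspace topology) is the image of $\iota(\mathbb P^r)^{\mathrm{an}}\subseteq(\mathbb P^n)^{\mathrm{an}}$ (Berkovich analytification) under $\operatorname{trop}_{\mathbb P^n}\colon(\mathbb P^n)^{\mathrm{an}}\to\mathbb T\mathbb P^n$, $x\mapsto[-\log|t_0|_x:\dots:-\log|t_n|_x]$, where $t_i$ are the homogeneous coordinates. It lies in $U^{\mathrm{trop}}$, the set of those $[u_0:\dots:u_n]\in\mathbb T\mathbb P^n$ such that the torus orbit $\{x_i=0\Leftrightarrow u_i=\infty\}$ is contained in $U$. A morphism $\varphi\colon U\to U'$, $[x_0:\dots:x_n]\mapsto[x_{\sigma(0)}:\dots:x_{\sigma(n')}]$, from $\iota\colon\mathbb P^r\hookrightarrow U\subseteq\mathbb P^n$ to $\iota'\colon\mathbb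 P^r\hookrightarrow U'\subseteq\mathbb P^{n'}$ in the category $I$ (so $\varphi\circ\iota=\iota'$) induces $\varphi^{\mathrm{trop}}\colon U^{\mathrm{trop}}\to U'^{\mathrm{trop}}$, $[u_0:\dots:u_n]\mapsto[u_{\sigma(0)}:\dots:u_{\sigma(n')}]$, which maps $\operatorname{Trop}(\mathbb P^r,\iota)$ to $\operatorname{Trop}(\mathbb P^r,\iota')$; these are the transition maps of the limit. The limit carries the coarsest topology making all projections continuous. For $\iota=[f_0:\dots:f_n]$ the map $\pi_\iota\colon\overline{\mathcal X}_r(K)\to\operatorname{Trop}(\mathbb P^r,\iota)$ is $\pi_\iota(x)=[-\log\|f_0\|_x:\dots:-\log\|f_n\|_x]$. *)

theory Defs
  imports "HOL-Analysis.Analysis" "HOL-Library.Poly_Mapping"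
begin

section \<open>Complete non-Archimedean fields\<close>

text \<open>The trivial absolute value is allowed.\<close>

locale complete_nonarch_field =
  fixes av :: "'k::field \<Rightarrow> real"
  assumes av_nonneg: "av a \<ge> 0"
    and av_eq_0_iff: "av a = 0 \<longleftrightarrow> a = 0"
    and av_mult: "av (a * b) = av a * av b"
    and av_add: "av (a + b) \<le> max (av a) (av b)"
    and av_complete: "Metric_space.mcomplete UNIV (\<lambda>a b. av (a - b))"


section \<open>Quotient topologies\<close>

text \<open>The final topology on \<open>f ` topspace X\<close> with respect to \<open>f\<close>.\<close>

definition quot_topology :: "'a topology \<Rightarrow> ('a \<Rightarrow> 'b) \<Rightarrow> 'b topology" where
  "quot_topology X f =
     topology (\<lambda>V. V \<subseteq> f ` topspace X \<and> openin X {x \<in> topspace X. f x \<in> V})"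

lemma openin_quot_topology:
  "openin (quot_topology X f) V \<longleftrightarrow>
     V \<subseteq> f ` topspace X \<and> openin X {x \<in> topspace X. f x \<in> V}"
proof -
  have "istopology (\<lambda>V. V \<subseteq> f ` topspace X \<and> openin X {x \<in> topspace X. f x \<in> V})"
    unfolding istopology_def
  proof (rule conjI; intro allI impI)
    fix S T
    assume S: "S \<subseteq> f ` topspace X \<and> openin X {x \<in> topspace X. f x \<in> S}"
      and T: "T \<subseteq> f ` topspace X \<and> openin X {x \<in> topspace X. f x \<in> T}"
    have "{x \<in> topspace X. f x \<in> S \<inter> T} =
        {x \<in> topspace X. f x \<in> S} \<inter> {x \<in> topspace X. f x \<in> T}"
      by blast
    with S T show "S \<inter> T \<subseteq> f ` topspace X \<and> openin X {x \<in> topspace X. f x \<in> S \<inter> T}"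
      by (metis (no_types, lifting) inf.coboundedI1 openin_Int)
  next
    fix \<K>
    assume K: "\<forall>V\<in>\<K>. V \<subseteq> f ` topspace X \<and> openin X {x \<in> topspace X. f x \<in> V}"
    have "{x \<in> topspace X. f x \<in> \<Union>\<K>} = (\<Union>V\<in>\<K>. {x \<in> topspace X. f x \<in> V})"
      by blast
    with K show "\<Union>\<K> \<subseteq> f ` topspace X \<and> openin X {x \<in> topspace X. f x \<in> \<Union>\<K>}"
      by (auto intro!: openin_Union)
  qed
  then show ?thesis
    by (simp add: quot_topology_def topology_inverse')
qed

lemma topspace_quot_topology [simp]: "topspace (quot_topology X f) = f ` topspace X"
proof (rule subset_antisym)
  show "topspace (quot_topology X f) \<subseteq> f ` topspace X"
    by (auto simp: topspace_def openin_quot_topology)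
  have "{x \<in> topspace X. f x \<in> f ` topspace X} = topspace X"
    by blast
  then have "openin (quot_topology X f) (f ` topspace X)"
    by (simp add: openin_quot_topology)
  then show "f ` topspace X \<subseteq> topspace (quot_topology X f)"
    by (rule openin_subset)
qed

lemma quotient_map_quot_topology: "quotient_map X (quot_topology X f) f"
  by (simp add: quotient_map_def openin_quot_topology)


section \<open>The space of seminorms modulo homothety\<close>

text \<open>Throughout, \<open>K\<^sup>r\<^sup>+\<^sup>1\<close> is \<open>'k ^ 'n\<close> with \<open>CARD('n) = r + 1\<close>; index types are nonempty,
  so \<open>r \<ge> 0\<close> is arbitrary. The dual space consists of the \<open>'k\<close>-linear functionals on it.\<close>

definition linear_forms :: "('k::field ^ 'n \<Rightarrow> 'k) set" where
  "linear_forms = {f. Vector_Spaces.linear (*s) (*) f}"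

definition nontriv_seminorms ::
    "('k::field \<Rightarrow> real) \<Rightarrow> (('k ^ 'n \<Rightarrow> 'k) \<Rightarrow> real) set" where
  "nontriv_seminorms av =
     {N \<in> extensional linear_forms.
        (\<forall>f\<in>linear_forms. N f \<ge> 0) \<and>
        (\<forall>c. \<forall>f\<in>linear_forms. N (\<lambda>v. c * f v) = av c * N f) \<and>
        (\<forall>f\<in>linear_forms. \<forall>g\<in>linear_forms. N (\<lambda>v. f v + g v) \<le> max (N f) (N g)) \<and>
        (\<exists>f\<in>linear_forms. N f \<noteq> 0)}"

definition seminorm_topology ::
    "('k::field \<Rightarrow> real) \<Rightarrow> (('k ^ 'n \<Rightarrow> 'k) \<Rightarrow> real) topology" where
  "seminorm_topology av =
     topology_generated_by
       {{N \<in> nontriv_seminorms av. N f \<in> V} |f V. f \<in> linear_forms \<and> open V}"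

definition homothety ::
    "('k::field \<Rightarrow> real) \<Rightarrow>
     ((('k ^ 'n \<Rightarrow> 'k) \<Rightarrow> real) \<times> (('k ^ 'n \<Rightarrow> 'k) \<Rightarrow> real)) set" where
  "homothety av =
     {(N, N'). N \<in> nontriv_seminorms av \<and> N' \<in> nontriv_seminorms av \<and>
        (\<exists>c>0. \<forall>f\<in>linear_forms. N' f = c * N f)}"

definition Xbar ::
    "('k::field \<Rightarrow> real) \<Rightarrow> (('k ^ 'n \<Rightarrow> 'k) \<Rightarrow> real) set topology" where
  "Xbar av = quot_topology (seminorm_topology av) (\<lambda>N. homothety av `` {N})"


section \<open>Tropical projective space\<close>

text \<open>\<open>\<real> \<union> {\<infinity>}\<close> is \<^typ>\<open>ereal\<close> without \<open>-\<infinity>\<close>, with the subspace topology.\<close>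

definition neg_log :: "real \<Rightarrow> ereal" where
  "neg_log a = (if a = 0 then \<infinity> else ereal (- ln a))"

definition trop_vectors :: "nat \<Rightarrow> (nat \<Rightarrow> ereal) set" where
  "trop_vectors n = {u \<in> {..n} \<rightarrow>\<^sub>E (UNIV - {-\<infinity>}). \<exists>i\<le>n. u i \<noteq> \<infinity>}"

definition trop_translation :: "nat \<Rightarrow> ((nat \<Rightarrow> ereal) \<times> (nat \<Rightarrow> ereal)) set" where
  "trop_translation n =
     {(u, u'). u \<in> trop_vectors n \<and> u' \<in> trop_vectors n \<and>
        (\<exists>c::real. \<forall>i\<le>n. u' i = u i + ereal c)}"

definition trop_point :: "nat \<Rightarrow> (nat \<Rightarrow> ereal) \<Rightarrow> (nat \<Rightarrow> ereal) set" where
  "trop_point n u = trop_translation n `` {\<lambda>i\<in>{..n}. u i}"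

definition trop_proj_space :: "nat \<Rightarrow> (nat \<Rightarrow> ereal) set topology" where
  "trop_proj_space n =
     quot_topology (subtopology (product_topology (\<lambda>_. euclidean) {..n}) (trop_vectors n))
       (trop_point n)"


section \<open>Polynomial rings\<close>

text \<open>\<open>K[t\<^sub>i | i \<in> I]\<close> is the subring \<open>mpolys I\<close> of the monoid algebra of \<open>'i \<Rightarrow>\<^sub>0 nat\<close>.\<close>

type_synonym ('i, 'k) mpoly = "('i \<Rightarrow>\<^sub>0 nat) \<Rightarrow>\<^sub>0 'k"

definition mpolys :: "'i set \<Rightarrow> ('i, 'k::field) mpoly set" where
  "mpolys I = {g. \<forall>m\<in>Poly_Mapping.keys g. Poly_Mapping.keys m \<subseteq> I}"

definition mp_const :: "'k::field \<Rightarrow> ('i, 'k) mpoly" where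
  "mp_const c = Poly_Mapping.single 0 c"

definition mp_var :: "'i \<Rightarrow> ('i, 'k::field) mpoly" where
  "mp_var i = Poly_Mapping.single (Poly_Mapping.single i 1) 1"

definition mp_subst ::
    "('i \<Rightarrow> ('j, 'k::field) mpoly) \<Rightarrow> ('i, 'k) mpoly \<Rightarrow> ('j, 'k) mpoly" where
  "mp_subst s g =
     (\<Sum>m\<in>Poly_Mapping.keys g. mp_const (Poly_Mapping.lookup g m) *
        (\<Prod>i\<in>Poly_Mapping.keys m. s i ^ Poly_Mapping.lookup m i))"

definition mono_degree :: "('i \<Rightarrow>\<^sub>0 nat) \<Rightarrow> nat" where
  "mono_degree m = (\<Sum>i\<in>Poly_Mapping.keys m. Poly_Mapping.lookup m i)"

definition homogeneous :: "nat \<Rightarrow> ('i, 'k::field) mpoly \<Rightarrow> bool" where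
  "homogeneous d g \<longleftrightarrow> (\<forall>m\<in>Poly_Mapping.keys g. mono_degree m = d)"

definition hom_component :: "nat \<Rightarrow> ('i, 'k::field) mpoly \<Rightarrow> ('i, 'k) mpoly" where
  "hom_component d g =
     (\<Sum>m\<in>{m \<in> Poly_Mapping.keys g. mono_degree m = d}.
        Poly_Mapping.single m (Poly_Mapping.lookup g m))"

text \<open>A linear form on \<open>K\<^sup>r\<^sup>+\<^sup>1\<close> as an element of the coordinate ring of \<open>P\<^sup>r\<close>.\<close>

definition form_poly :: "('k::field ^ 'n \<Rightarrow> 'k) \<Rightarrow> ('n::finite, 'k) mpoly" where
  "form_poly f = (\<Sum>i\<in>UNIV. mp_const (f (axis i 1)) * mp_var i)"


section \<open>Projective space as a scheme and its toric open subsets\<close>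

text \<open>The points of \<open>Proj K[t\<^sub>i | i \<in> I]\<close>.\<close>

definition homogeneous_prime :: "'i set \<Rightarrow> ('i, 'k::field) mpoly set \<Rightarrow> bool" where
  "homogeneous_prime I P \<longleftrightarrow>
     P \<subseteq> mpolys I \<and> 0 \<in> P \<and> 1 \<notin> P \<and>
     (\<forall>g\<in>P. \<forall>h\<in>P. g + h \<in> P) \<and>
     (\<forall>g\<in>mpolys I. \<forall>h\<in>P. g * h \<in> P) \<and>
     (\<forall>g\<in>mpolys I. \<forall>h\<in>mpolys I. g * h \<in> P \<longrightarrow> g \<in> P \<or> h \<in> P) \<and>
     (\<forall>g\<in>P. \<forall>d. hom_component d g \<in> P)"

definition proj_points :: "'i set \<Rightarrow> ('i, 'k::field) mpoly set set" where
  "proj_points I = {P. homogeneous_prime I P \<and> (\<exists>i\<in>I. mp_var i \<notin> P)}"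

definition zariski_open :: "'i set \<Rightarrow> ('i, 'k::field) mpoly set set \<Rightarrow> bool" where
  "zariski_open I U \<longleftrightarrow> (\<exists>A\<subseteq>mpolys I. U = {P \<in> proj_points I. \<not> A \<subseteq> P})"

text \<open>The orbits of the big torus (a group scheme; \<open>K\<close> may be finite) are the locally closed
  subsets on which a prescribed set of homogeneous coordinates vanishes. A set is invariant iff
  it is a union of orbits.\<close>

definition torus_invariant :: "'i set \<Rightarrow> ('i, 'k::field) mpoly set set \<Rightarrow> bool" where
  "torus_invariant I U \<longleftrightarrow>
     (\<forall>P\<in>U. \<forall>Q\<in>proj_points I. (\<forall>i\<in>I. mp_var i \<in> P \<longleftrightarrow> mp_var i \<in> Q) \<longrightarrow> Q \<in> U)"

text \<open>The image of the point \<open>P\<close> under the (rational) map to \<open>Proj K[t\<^sub>i | i \<in> I]\<close> given by the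
  forms \<open>s i\<close> of equal degree. It is defined at \<open>P\<close> iff the result is in \<^term>\<open>proj_points I\<close>.\<close>

definition proj_map ::
    "'i set \<Rightarrow> ('i \<Rightarrow> ('j, 'k::field) mpoly) \<Rightarrow> ('j, 'k) mpoly set \<Rightarrow> ('i, 'k) mpoly set" where
  "proj_map I s P = {g \<in> mpolys I. mp_subst s g \<in> P}"


section \<open>The category of linear closed immersions\<close>

text \<open>A tuple \<open>f\<^sub>0, \<dots>, f\<^sub>n\<close> spanning the dual space, and the linear map \<open>[f\<^sub>0 : \<dots> : f\<^sub>n]\<close>
  from \<open>P\<^sup>r\<close> to \<open>P\<^sup>n\<close>, i.e. the tuple up to a nonzero scalar.\<close>

definition spanning_forms :: "nat \<Rightarrow> (nat \<Rightarrow> 'k::field ^ 'n \<Rightarrow> 'k) \<Rightarrow> bool" where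
  "spanning_forms n f \<longleftrightarrow>
     f \<in> {..n} \<rightarrow>\<^sub>E linear_forms \<and>
     (\<forall>g\<in>linear_forms. \<exists>a. g = (\<lambda>v. \<Sum>i\<le>n. a i * f i v))"

definition linear_map_class ::
    "nat \<Rightarrow> (nat \<Rightarrow> 'k::field ^ 'n \<Rightarrow> 'k) \<Rightarrow> (nat \<Rightarrow> 'k ^ 'n \<Rightarrow> 'k) set" where
  "linear_map_class n f = {\<lambda>i\<in>{..n}. \<lambda>v. c * f i v |c. c \<noteq> 0}"

text \<open>An object \<open>P\<^sup>r \<rightarrow> U \<subseteq> P\<^sup>n\<close> is the triple of \<open>n\<close>, the map to \<open>P\<^sup>n\<close>, and \<open>U\<close>.\<close>

type_synonym ('k, 'n) immersion =
  "nat \<times> (nat \<Rightarrow> 'k ^ 'n \<Rightarrow> 'k) set \<times> (nat, 'k) mpoly set set"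

definition immersions :: "('k::field, 'n::finite) immersion set" where
  "immersions =
     {(n, linear_map_class n f, U) |n f U.
        spanning_forms n f \<and> zariski_open {..n} U \<and> torus_invariant {..n} U \<and>
        (\<forall>P\<in>proj_points (UNIV :: 'n set). proj_map {..n} (\<lambda>i. form_poly (f i)) P \<in> U)}"

text \<open>A morphism is given by an index map \<open>\<sigma>\<close> such that
  \<open>\<phi> = [x\<^bsub>\<sigma> 0\<^esub> : \<dots> : x\<^bsub>\<sigma> n'\<^esub>]\<close> is defined on \<open>U\<close>, maps \<open>U\<close> into \<open>U'\<close>, and satisfies
  \<open>\<phi> \<circ> \<iota> = \<iota>'\<close>.\<close>

fun immersion_morphism ::
    "('k::field, 'n::finite) immersion \<Rightarrow> ('k, 'n) immersion \<Rightarrow> (nat \<Rightarrow> nat) \<Rightarrow> bool" where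
  "immersion_morphism (n, \<iota>, U) (n', \<iota>', U') \<sigma> \<longleftrightarrow>
     \<sigma> \<in> {..n'} \<rightarrow>\<^sub>E {..n} \<and>
     (\<forall>P\<in>U. proj_map {..n'} (\<lambda>j. mp_var (\<sigma> j)) P \<in> U') \<and>
     (\<lambda>f. \<lambda>j\<in>{..n'}. f (\<sigma> j)) ` \<iota> = \<iota>'"


section \<open>Analytification and tropicalization\<close>

text \<open>Points of the analytification of \<open>P\<^sup>n\<close> are multiplicative seminorms on
  \<open>K[t\<^sub>0, \<dots>, t\<^sub>n]\<close> extending the absolute value and not vanishing on all \<open>t\<^sub>i\<close>, where two of them
  are identified if on forms of degree \<open>d\<close> they differ by the factor \<open>c\<^sup>d\<close>.\<close>

definition mult_seminorms ::
    "('k::field \<Rightarrow> real) \<Rightarrow> nat \<Rightarrow> ((nat, 'k) mpoly \<Rightarrow> real) set" where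
  "mult_seminorms av n =
     {x \<in> extensional (mpolys {..n}).
        (\<forall>g\<in>mpolys {..n}. x g \<ge> 0) \<and>
        (\<forall>c. x (mp_const c) = av c) \<and>
        (\<forall>g\<in>mpolys {..n}. \<forall>h\<in>mpolys {..n}. x (g * h) = x g * x h) \<and>
        (\<forall>g\<in>mpolys {..n}. \<forall>h\<in>mpolys {..n}. x (g + h) \<le> max (x g) (x h)) \<and>
        (\<exists>i\<le>n. x (mp_var i) \<noteq> 0)}"

definition analytic_equiv ::
    "('k::field \<Rightarrow> real) \<Rightarrow> nat \<Rightarrow>
     (((nat, 'k) mpoly \<Rightarrow> real) \<times> ((nat, 'k) mpoly \<Rightarrow> real)) set" where
  "analytic_equiv av n =
     {(x, y). x \<in> mult_seminorms av n \<and> y \<in> mult_seminorms av n \<and>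
        (\<exists>c>0. \<forall>d. \<forall>g\<in>mpolys {..n}. homogeneous d g \<longrightarrow> y g = c ^ d * x g)}"

definition proj_analytification ::
    "('k::field \<Rightarrow> real) \<Rightarrow> nat \<Rightarrow> ((nat, 'k) mpoly \<Rightarrow> real) set set" where
  "proj_analytification av n = mult_seminorms av n // analytic_equiv av n"

text \<open>The homogeneous ideal of the closed subscheme \<open>\<iota>(P\<^sup>r)\<close> of \<open>P\<^sup>n\<close>.\<close>

definition image_ideal ::
    "nat \<Rightarrow> (nat \<Rightarrow> 'k::field ^ 'n \<Rightarrow> 'k) set \<Rightarrow> (nat, 'k) mpoly set" where
  "image_ideal n \<iota> =
     {g \<in> mpolys {..n}. \<forall>f\<in>\<iota>. mp_subst (\<lambda>i. form_poly (f i) :: ('n::finite, 'k) mpoly) g = 0}"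

definition image_analytification ::
    "('k::field \<Rightarrow> real) \<Rightarrow> nat \<Rightarrow> (nat \<Rightarrow> 'k ^ 'n::finite \<Rightarrow> 'k) set \<Rightarrow>
     ((nat, 'k) mpoly \<Rightarrow> real) set set" where
  "image_analytification av n \<iota> =
     {p \<in> proj_analytification av n. \<forall>x\<in>p. \<forall>g\<in>image_ideal n \<iota>. x g = 0}"

text \<open>Maps out of quotients are written as unions over all representatives; each representative
  contributes the same class.\<close>

definition trop_map :: "nat \<Rightarrow> ((nat, 'k::field) mpoly \<Rightarrow> real) set \<Rightarrow> (nat \<Rightarrow> ereal) set" where
  "trop_map n p = (\<Union>x\<in>p. trop_point n (\<lambda>i. neg_log (x (mp_var i))))"

fun Trop ::
    "('k::field \<Rightarrow> real) \<Rightarrow> ('k, 'n::finite) immersion \<Rightarrow> (nat \<Rightarrow> ereal) set topology" where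
  "Trop av (n, \<iota>, U) =
     subtopology (trop_proj_space n) (trop_map n ` image_analytification av n \<iota>)"

text \<open>The map \<open>[u\<^sub>0 : \<dots> : u\<^sub>n] \<mapsto> [u\<^bsub>\<sigma> 0\<^esub> : \<dots> : u\<^bsub>\<sigma> n'\<^esub>]\<close> induced by a morphism. It is
  meaningful on the tropicalization of \<open>U\<close>, which contains the space \<open>Trop\<close> of the source.\<close>

fun trop_transition ::
    "('k, 'n) immersion \<Rightarrow> (nat \<Rightarrow> nat) \<Rightarrow> (nat \<Rightarrow> ereal) set \<Rightarrow> (nat \<Rightarrow> ereal) set" where
  "trop_transition (n', \<iota>', U') \<sigma> y = (\<Union>u\<in>y. trop_point n' (\<lambda>j. u (\<sigma> j)))"

definition trop_limit ::
    "('k::field \<Rightarrow> real) \<Rightarrow> (('k, 'n::finite) immersion \<Rightarrow> (nat \<Rightarrow> ereal) set) topology" where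
  "trop_limit av =
     subtopology (product_topology (Trop av) immersions)
       {y. \<forall>i\<in>immersions. \<forall>j\<in>immersions. \<forall>\<sigma>.
             immersion_morphism i j \<sigma> \<longrightarrow> trop_transition j \<sigma> (y i) = y j}"

fun seminorm_trop ::
    "('k, 'n) immersion \<Rightarrow> (('k::field ^ 'n \<Rightarrow> 'k) \<Rightarrow> real) set \<Rightarrow> (nat \<Rightarrow> ereal) set" where
  "seminorm_trop (n, \<iota>, U) x =
     (\<Union>f\<in>\<iota>. \<Union>N\<in>x. trop_point n (\<lambda>i. neg_log (N (f i))))"

end

theory Submission
  imports Defs
begin

text \<open>A point of the limit assigns to every linear immersion \<open>[f\<^sub>0 : \<dots> : f\<^sub>n]\<close> a tropical point, and the
  theorem says that these points are the values of one seminorm, unique up to homothety.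

  The link between seminorms on linear forms and points of \<open>Trop\<close> is the following (lemmas
  \<open>trop_of_seminorm\<close> and \<open>seminorm_of_trop\<close>): the points of \<open>Trop(P\<^sup>r, [f\<^sub>0 : \<dots> : f\<^sub>n])\<close> are exactly the
  \<open>[-log N(f\<^sub>0) : \<dots> : -log N(f\<^sub>n)]\<close> for nontrivial seminorms \<open>N\<close>. In one direction, a multiplicative
  seminorm that vanishes on the ideal of the image restricts to the linear polynomials, and there it
  factors through the space of linear forms. In the other direction \<open>N\<close> has to be extended to a
  multiplicative seminorm on polynomials. A norm over a field that is not spherically complete need
  not have an orthogonal basis, but only the finitely many values \<open>N(f\<^sub>i)\<close> matter: among the \<open>f\<^sub>i\<close> there
  is a basis with respect to which the weighted maximum norm takes the same values on all \<open>f\<^sub>i\<close>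
  (\<open>reduced_generators\<close>). The extension is then a Gauss seminorm in the coordinates of that basis,
  and its multiplicativity is the Gauss lemma \<open>gauss_mult\<close>.

  The transition maps glue these seminorms. A selection of the coordinates that still spans is a
  morphism once the source \<open>U\<close> is shrunk to the domain of definition of the coordinate projection;
  such \<open>U\<close> is torus-invariant. Shrinking \<open>U\<close> does not change the tropical point, because the identity
  of coordinates is a morphism, too. Hence for each finite set \<open>S\<close> of linear forms that contains the
  coordinate forms, one seminorm realizes the given point of the limit on all tuples from \<open>S\<close>
  (\<open>realizes_finite\<close>), and it is determined on \<open>S\<close> up to a factor. After normalizing at one coordinate
  form these seminorms agree on common arguments, so that they define one seminorm on all linear
  forms; the axioms of a seminorm involve only finitely many forms at a time (\<open>realizes_exists\<close>).
  Uniqueness up to homothety gives injectivity.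

  Continuity is a matter of the coordinates \<open>N \<mapsto> N(f)\<close>. For openness, the limit is covered by the
  open sets on which a coordinate form \<open>e\<close> has a nonzero value. On such a set the seminorm with
  \<open>N(e) = 1\<close> is a section of the map to the limit, and it is continuous, since each value \<open>N(g)\<close> is a
  ratio of two coordinates of one tropical point (\<open>openin_ratio_set\<close>, \<open>open_map_trop_family\<close>).\<close>

section \<open>Polynomials: substitution and grading\<close>

lemma mpolys_0 [simp]: "0 \<in> mpolys I"
  by (simp add: mpolys_def)

lemma mpolys_1 [simp]: "1 \<in> mpolys I"
  by (simp add: mpolys_def)

lemma mpolys_const [simp]: "mp_const c \<in> mpolys I"
  by (simp add: mpolys_def mp_const_def)

lemma mpolys_var: "i \<in> I \<Longrightarrow> mp_var i \<in> mpolys I"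
  by (simp add: mpolys_def mp_var_def)

lemma mpolys_UNIV [simp]: "g \<in> mpolys UNIV"
  by (simp add: mpolys_def)

lemma mpolys_add: "g \<in> mpolys I \<Longrightarrow> h \<in> mpolys I \<Longrightarrow> g + h \<in> mpolys I"
  using Poly_Mapping.keys_add[of g h] unfolding mpolys_def by blast

lemma keys_add_nat: "Poly_Mapping.keys (m + m') = Poly_Mapping.keys m \<union> Poly_Mapping.keys m'"
  for m m' :: "'i \<Rightarrow>\<^sub>0 nat"
  by (auto simp: in_keys_iff lookup_add)

lemma mpolys_mult:
  assumes "g \<in> mpolys I" "h \<in> mpolys I"
  shows "g * h \<in> mpolys I"
  unfolding mpolys_def
proof (intro CollectI ballI)
  fix m assume "m \<in> Poly_Mapping.keys (g * h)"
  then obtain a b where "m = a + b" "a \<in> Poly_Mapping.keys g" "b \<in> Poly_Mapping.keys h"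
    using keys_mult by blast
  with assms show "Poly_Mapping.keys m \<subseteq> I"
    by (auto simp: mpolys_def keys_add_nat)
qed

lemma mpolys_sum: "(\<And>a. a \<in> A \<Longrightarrow> g a \<in> mpolys I) \<Longrightarrow> sum g A \<in> mpolys I"
  by (induction A rule: infinite_finite_induct) (auto intro: mpolys_add)

lemma mpolys_prod: "(\<And>a. a \<in> A \<Longrightarrow> g a \<in> mpolys I) \<Longrightarrow> prod g A \<in> mpolys I"
  by (induction A rule: infinite_finite_induct) (auto intro: mpolys_mult)

lemma mpolys_power: "g \<in> mpolys I \<Longrightarrow> g ^ k \<in> mpolys I"
  by (induction k) (auto intro: mpolys_mult)

lemma sum_monomials:
  "(\<Sum>m\<in>Poly_Mapping.keys g. Poly_Mapping.single m (Poly_Mapping.lookup g m)) = g"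
  by (rule poly_mapping_eqI)
    (auto simp: lookup_sum lookup_single when_def sum.delta' in_keys_iff)

lemma mpolys_induct [consumes 1, case_names monomial add]:
  assumes "g \<in> mpolys I"
    and mono: "\<And>m c. Poly_Mapping.keys m \<subseteq> I \<Longrightarrow> P (Poly_Mapping.single m c)"
    and add: "\<And>g h. P g \<Longrightarrow> P h \<Longrightarrow> P (g + h)"
  shows "P g"
proof -
  have P0: "P 0" using mono[of 0 0] by simp
  have "P (\<Sum>m\<in>A. Poly_Mapping.single m (Poly_Mapping.lookup g m))"
    if "A \<subseteq> Poly_Mapping.keys g" for A
  proof -
    have "finite A" using that finite_keys finite_subset by blast
    then show ?thesis using that
  proof (induction A rule: finite_induct)
    case (insert m A)
    with assms(1) show ?case
      by (auto simp: mpolys_def intro!: add mono)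
  qed (simp add: P0)
  qed
  from this[OF order.refl] show ?thesis
    by (simp add: sum_monomials)
qed

lemma mp_const_0 [simp]: "mp_const 0 = 0"
  by (simp add: mp_const_def)

lemma mp_const_1 [simp]: "mp_const 1 = 1"
  by (simp add: mp_const_def)

lemma mp_const_add: "mp_const (a + b) = mp_const a + mp_const b"
  by (simp add: mp_const_def single_add)

lemma mp_const_mult: "mp_const (a * b) = mp_const a * mp_const b"
  by (simp add: mp_const_def mult_single)

lemma mp_const_sum: "mp_const (sum a A) = (\<Sum>i\<in>A. mp_const (a i))"
  by (induction A rule: infinite_finite_induct) (auto simp: mp_const_add)

text \<open>The value of a monomial under a substitution. Splitting it off reduces the fact that
  \<^const>\<open>mp_subst\<close> is a ring homomorphism to the multiplicativity of this function.\<close>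

definition mono_subst :: "('i \<Rightarrow> ('j, 'k::field) mpoly) \<Rightarrow> ('i \<Rightarrow>\<^sub>0 nat) \<Rightarrow> ('j, 'k) mpoly" where
  "mono_subst s m = (\<Prod>i\<in>Poly_Mapping.keys m. s i ^ Poly_Mapping.lookup m i)"

lemma mono_subst_superset:
  assumes "finite A" "Poly_Mapping.keys m \<subseteq> A"
  shows "mono_subst s m = (\<Prod>i\<in>A. s i ^ Poly_Mapping.lookup m i)"
  unfolding mono_subst_def
  by (rule prod.mono_neutral_left) (use assms in \<open>auto simp: in_keys_iff\<close>)

lemma mono_subst_add: "mono_subst s (m + m') = mono_subst s m * mono_subst s m'"
proof -
  let ?A = "Poly_Mapping.keys m \<union> Poly_Mapping.keys m'"
  have "mono_subst s (m + m') = (\<Prod>i\<in>?A. s i ^ Poly_Mapping.lookup (m + m') i)"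
    by (rule mono_subst_superset) (auto simp: keys_add_nat)
  also have "\<dots> = (\<Prod>i\<in>?A. s i ^ Poly_Mapping.lookup m i) * (\<Prod>i\<in>?A. s i ^ Poly_Mapping.lookup m' i)"
    by (simp add: lookup_add power_add prod.distrib)
  finally show ?thesis
    by (simp add: mono_subst_superset[of ?A])
qed

lemma mp_subst_superset:
  assumes "finite A" "Poly_Mapping.keys g \<subseteq> A"
  shows "mp_subst s g = (\<Sum>m\<in>A. mp_const (Poly_Mapping.lookup g m) * mono_subst s m)"
  unfolding mp_subst_def mono_subst_def
  by (rule sum.mono_neutral_left) (use assms in \<open>auto simp: in_keys_iff\<close>)

lemma mp_subst_single: "mp_subst s (Poly_Mapping.single m c) = mp_const c * mono_subst s m"
  by (subst mp_subst_superset[of "{m}"]) auto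

lemma mp_subst_add: "mp_subst s (g + h) = mp_subst s g + mp_subst s h"
proof -
  let ?A = "Poly_Mapping.keys g \<union> Poly_Mapping.keys h"
  have "mp_subst s (g + h) = (\<Sum>m\<in>?A. mp_const (Poly_Mapping.lookup (g + h) m) * mono_subst s m)"
    by (rule mp_subst_superset) (auto simp: Poly_Mapping.keys_add)
  then show ?thesis
    by (simp add: mp_subst_superset[of ?A] lookup_add mp_const_add distrib_right sum.distrib)
qed

lemma mp_subst_mult: "mp_subst s (g * h) = mp_subst s g * mp_subst s h"
proof -
  have "\<forall>h. mp_subst s (g * h) = mp_subst s g * mp_subst s h"
    using mpolys_UNIV[of g]
  proof (induction g rule: mpolys_induct)
    case (monomial m c)
    show ?case
    proof
      fix h
      show "mp_subst s (Poly_Mapping.single m c * h)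
          = mp_subst s (Poly_Mapping.single m c) * mp_subst s h"
        using mpolys_UNIV[of h]
      proof (induction h rule: mpolys_induct)
        case (monomial m' c')
        then show ?case
          by (simp add: mult_single mp_subst_single mono_subst_add mp_const_mult mult_ac)
      qed (simp add: distrib_left mp_subst_add)
    qed
  qed (simp add: distrib_right mp_subst_add)
  then show ?thesis by blast
qed

lemma mp_subst_const [simp]: "mp_subst s (mp_const c) = mp_const c"
  unfolding mp_const_def[of c] mp_subst_single by (simp add: mono_subst_def mp_const_def)

lemma mp_subst_0 [simp]: "mp_subst s 0 = 0"
  by (simp add: mp_subst_def)

lemma mp_subst_1 [simp]: "mp_subst s 1 = 1"
  using mp_subst_const[of s 1] by simp

lemma mp_subst_var [simp]: "mp_subst s (mp_var i) = s i"
  by (simp add: mp_var_def mp_subst_single mono_subst_def)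

lemma mp_subst_sum: "mp_subst s (sum g A) = (\<Sum>a\<in>A. mp_subst s (g a))"
  by (induction A rule: infinite_finite_induct) (auto simp: mp_subst_add)

lemma mp_subst_mpolys:
  assumes "g \<in> mpolys I" "\<And>i. i \<in> I \<Longrightarrow> s i \<in> mpolys J"
  shows "mp_subst s g \<in> mpolys J"
  using assms(1)
proof (induction g rule: mpolys_induct)
  case (monomial m c)
  then show ?case
    unfolding mp_subst_single mono_subst_def
    by (intro mpolys_mult mpolys_prod mpolys_power mpolys_const assms(2)) auto
qed (simp add: mp_subst_add mpolys_add)

lemma mono_degree_add: "mono_degree (m + m') = mono_degree m + mono_degree m'"
proof -
  let ?A = "Poly_Mapping.keys m \<union> Poly_Mapping.keys m'"
  have *: "mono_degree m = (\<Sum>i\<in>?A. Poly_Mapping.lookup m i)"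
    if "Poly_Mapping.keys m \<subseteq> ?A" for m
    unfolding mono_degree_def
    by (rule sum.mono_neutral_left) (use that in \<open>auto simp: in_keys_iff\<close>)
  show ?thesis
    by (simp add: * keys_add_nat lookup_add sum.distrib)
qed

lemma homogeneous_add: "homogeneous d g \<Longrightarrow> homogeneous d h \<Longrightarrow> homogeneous d (g + h)"
  using Poly_Mapping.keys_add[of g h] unfolding homogeneous_def by blast

lemma homogeneous_mult: "homogeneous d g \<Longrightarrow> homogeneous e h \<Longrightarrow> homogeneous (d + e) (g * h)"
  using keys_mult[of g h] unfolding homogeneous_def by (fastforce simp: mono_degree_add)

lemma homogeneous_const: "homogeneous 0 (mp_const c)"
  by (simp add: homogeneous_def mp_const_def mono_degree_def)

lemma homogeneous_var: "homogeneous 1 (mp_var i)"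
  by (simp add: homogeneous_def mp_var_def mono_degree_def)

lemma homogeneous_power: "homogeneous d g \<Longrightarrow> homogeneous (k * d) (g ^ k)"
  by (induction k) (auto dest: homogeneous_mult simp: homogeneous_const[of 1, simplified])

lemma homogeneous_prod:
  "(\<And>a. a \<in> A \<Longrightarrow> homogeneous (d a) (g a)) \<Longrightarrow> homogeneous (sum d A) (prod g A)"
  by (induction A rule: infinite_finite_induct)
    (auto intro: homogeneous_mult simp: homogeneous_const[of 1, simplified])

lemma homogeneous_sum:
  "(\<And>a. a \<in> A \<Longrightarrow> homogeneous d (g a)) \<Longrightarrow> homogeneous d (sum g A)"
  by (induction A rule: infinite_finite_induct)
    (auto intro: homogeneous_add simp: homogeneous_def[of _ 0])

lemma lookup_hom_component:
  "Poly_Mapping.lookup (hom_component d g) m =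
    (if mono_degree m = d then Poly_Mapping.lookup g m else 0)"
  by (auto simp: hom_component_def lookup_sum lookup_single when_def sum.delta' in_keys_iff)

lemma hom_component_mpolys: "g \<in> mpolys I \<Longrightarrow> hom_component d g \<in> mpolys I"
  by (auto simp: mpolys_def in_keys_iff lookup_hom_component split: if_splits)

lemma hom_component_add: "hom_component d (g + h) = hom_component d g + hom_component d h"
  by (rule poly_mapping_eqI) (simp add: lookup_hom_component lookup_add)

lemma hom_component_homogeneous:
  "homogeneous e g \<Longrightarrow> hom_component d g = (if d = e then g else 0)"
  by (rule poly_mapping_eqI) (auto simp: lookup_hom_component homogeneous_def in_keys_iff)

lemma homogeneous_hom_component: "homogeneous d (hom_component d g)"
  by (auto simp: homogeneous_def in_keys_iff lookup_hom_component split: if_splits)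

lemma sum_hom_components:
  "(\<Sum>d\<in>mono_degree ` Poly_Mapping.keys g. hom_component d g) = g"
  by (rule poly_mapping_eqI)
    (auto simp: lookup_sum lookup_hom_component sum.delta' in_keys_iff)

text \<open>Substituting forms of degree one preserves degrees. This is why the preimage of a homogeneous
  ideal under such a substitution is again homogeneous.\<close>

lemma hom_component_subst:
  assumes "\<And>i. homogeneous 1 (s i)"
  shows "hom_component d (mp_subst s g) = mp_subst s (hom_component d g)"
  using mpolys_UNIV[of g]
proof (induction g rule: mpolys_induct)
  case (monomial m c)
  have "homogeneous (\<Sum>i\<in>Poly_Mapping.keys m. Poly_Mapping.lookup m i * 1) (mono_subst s m)"
    unfolding mono_subst_def by (intro homogeneous_prod homogeneous_power assms)
  then have s: "homogeneous (mono_degree m) (mp_subst s (Poly_Mapping.single m c))"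
    using homogeneous_mult[OF homogeneous_const] by (fastforce simp: mp_subst_single mono_degree_def)
  have "homogeneous (mono_degree m) (Poly_Mapping.single m c)"
    by (auto simp: homogeneous_def)
  with s show ?case
    by (simp add: hom_component_homogeneous)
qed (simp add: hom_component_add mp_subst_add)

lemma proj_map_homogeneous_prime:
  assumes P: "homogeneous_prime J P"
    and s: "\<And>i. homogeneous 1 (s i)" "\<And>i. i \<in> I \<Longrightarrow> s i \<in> mpolys J"
  shows "homogeneous_prime I (proj_map I s P)"
proof -
  have *: "mp_subst s g \<in> mpolys J" if "g \<in> mpolys I" for g
    by (rule mp_subst_mpolys[OF that s(2)])
  show ?thesis
    using P unfolding homogeneous_prime_def proj_map_def
    by (auto simp: mp_subst_add mp_subst_mult * mpolys_add mpolys_mult hom_component_mpolys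
        hom_component_subst[OF s(1), symmetric])
qed

text \<open>A preimage of a homogeneous prime is one again; it is a point of the projective space as soon
  as one of the forms that define the map does not vanish at the given point.\<close>

lemma proj_map_in_proj_points:
  assumes P: "P \<in> proj_points J"
    and s: "\<And>i. homogeneous 1 (s i)" "\<And>i. i \<in> I \<Longrightarrow> s i \<in> mpolys J"
    and i: "i \<in> I" "s i \<notin> P"
  shows "proj_map I s P \<in> proj_points I"
  unfolding proj_points_def
proof (intro CollectI conjI bexI)
  show "homogeneous_prime I (proj_map I s P)"
    using P by (intro proj_map_homogeneous_prime s(1)) (auto simp: proj_points_def s(2))
  show "mp_var i \<notin> proj_map I s P"
    using i by (simp add: proj_map_def)
qed (use i in auto)

section \<open>Gauss seminorms\<close>

definition mono_weight :: "('i \<Rightarrow> real) \<Rightarrow> ('i \<Rightarrow>\<^sub>0 nat) \<Rightarrow> real" where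
  "mono_weight w m = (\<Prod>i\<in>Poly_Mapping.keys m. w i ^ Poly_Mapping.lookup m i)"

lemma mono_weight_superset:
  assumes "finite A" "Poly_Mapping.keys m \<subseteq> A"
  shows "mono_weight w m = (\<Prod>i\<in>A. w i ^ Poly_Mapping.lookup m i)"
  unfolding mono_weight_def
  by (rule prod.mono_neutral_left) (use assms in \<open>auto simp: in_keys_iff\<close>)

lemma mono_weight_add: "mono_weight w (m + m') = mono_weight w m * mono_weight w m'"
proof -
  let ?A = "Poly_Mapping.keys m \<union> Poly_Mapping.keys m'"
  have "mono_weight w (m + m') = (\<Prod>i\<in>?A. w i ^ Poly_Mapping.lookup (m + m') i)"
    by (rule mono_weight_superset) (auto simp: keys_add_nat)
  also have "\<dots> = (\<Prod>i\<in>?A. w i ^ Poly_Mapping.lookup m i) * (\<Prod>i\<in>?A. w i ^ Poly_Mapping.lookup m' i)"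
    by (simp add: lookup_add power_add prod.distrib)
  finally show ?thesis
    by (simp add: mono_weight_superset[of ?A])
qed

lemma mono_weight_nonneg: "(\<And>i. w i \<ge> 0) \<Longrightarrow> mono_weight w m \<ge> 0"
  unfolding mono_weight_def by (intro prod_nonneg) auto

lemma lookup_times:
  "Poly_Mapping.lookup (g * h) k =
    (\<Sum>(a, b)\<in>Poly_Mapping.keys g \<times> Poly_Mapping.keys h.
       if a + b = k then Poly_Mapping.lookup g a * Poly_Mapping.lookup h b else 0)"
proof -
  have "g * h = (\<Sum>a\<in>Poly_Mapping.keys g. Poly_Mapping.single a (Poly_Mapping.lookup g a)) *
      (\<Sum>b\<in>Poly_Mapping.keys h. Poly_Mapping.single b (Poly_Mapping.lookup h b))"
    by (simp add: sum_monomials)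
  also have "\<dots> = (\<Sum>(a, b)\<in>Poly_Mapping.keys g \<times> Poly_Mapping.keys h.
      Poly_Mapping.single (a + b) (Poly_Mapping.lookup g a * Poly_Mapping.lookup h b))"
    by (simp add: sum_product mult_single sum.cartesian_product)
  finally show ?thesis
    by (simp add: lookup_sum lookup_single when_def case_prod_unfold)
qed

context complete_nonarch_field begin

lemma av_0 [simp]: "av 0 = 0"
  by (simp add: av_eq_0_iff)

lemma av_pos: "a \<noteq> 0 \<Longrightarrow> av a > 0"
  using av_nonneg[of a] av_eq_0_iff[of a] by linarith

lemma av_1 [simp]: "av 1 = 1"
  using av_mult[of 1 1] av_eq_0_iff[of 1] by simp

lemma av_minus [simp]: "av (- a) = av a"
proof -
  have "av (-1) * av (-1) = 1"
    using av_mult[of "-1" "-1"] by simp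
  then have "av (-1) = 1"
    using av_nonneg[of "-1"] by (metis power2_eq_square power2_eq_1_iff abs_of_nonneg abs_1 abs_minus_cancel)
  then show ?thesis
    using av_mult[of "-1" a] by simp
qed

lemma av_divide: "av (a / b) = av a / av b"
proof (cases "b = 0")
  case False
  then have "av (a / b) * av b = av a"
    by (simp flip: av_mult)
  with False show ?thesis
    by (simp add: nonzero_eq_divide_eq av_eq_0_iff)
qed simp

lemma av_sum_le:
  assumes "C \<ge> 0" "\<And>i. i \<in> A \<Longrightarrow> av (a i) \<le> C"
  shows "av (sum a A) \<le> C"
  using assms(2)
proof (induction A rule: infinite_finite_induct)
  case (insert i A)
  then show ?case using av_add[of "a i" "sum a A"] by fastforce
qed (use assms(1) in auto)

lemma av_sum_less:
  assumes "C > 0" "\<And>i. i \<in> A \<Longrightarrow> av (a i) < C"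
  shows "av (sum a A) < C"
  using assms(2)
proof (induction A rule: infinite_finite_induct)
  case (insert i A)
  then show ?case using av_add[of "a i" "sum a A"] by fastforce
qed (use assms(1) in auto)

lemma av_add_dominant:
  assumes "av b < av a"
  shows "av (a + b) = av a"
proof -
  have "av a \<le> max (av (a + b)) (av b)"
    using av_add[of "a + b" "- b"] by simp
  with assms av_add[of a b] show ?thesis by auto
qed

text \<open>The largest term of a polynomial when the variable \<open>i\<close> has absolute value \<open>w i\<close>. The value \<open>0\<close> is
  inserted for the zero polynomial, which has no terms.\<close>

definition gauss :: "('i \<Rightarrow> real) \<Rightarrow> ('i, 'k) mpoly \<Rightarrow> real" where
  "gauss w g = Max (insert 0
     ((\<lambda>m. av (Poly_Mapping.lookup g m) * mono_weight w m) ` Poly_Mapping.keys g))"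

lemma gauss_nonneg: "gauss w g \<ge> 0"
  unfolding gauss_def by (rule Max_ge) auto

lemma gauss_ge: "av (Poly_Mapping.lookup g m) * mono_weight w m \<le> gauss w g"
proof (cases "m \<in> Poly_Mapping.keys g")
  case True
  then show ?thesis unfolding gauss_def by (intro Max_ge) auto
next
  case False
  then show ?thesis using gauss_nonneg[of w g] by (simp add: in_keys_iff)
qed

lemma gauss_le:
  assumes "C \<ge> 0" "\<And>m. av (Poly_Mapping.lookup g m) * mono_weight w m \<le> C"
  shows "gauss w g \<le> C"
  unfolding gauss_def using assms by (subst Max_le_iff) auto

lemma gauss_attained:
  assumes "gauss w g > 0"
  obtains m where "m \<in> Poly_Mapping.keys g"
    "av (Poly_Mapping.lookup g m) * mono_weight w m = gauss w g"
proof -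
  have "gauss w g \<in> insert 0
     ((\<lambda>m. av (Poly_Mapping.lookup g m) * mono_weight w m) ` Poly_Mapping.keys g)"
    unfolding gauss_def by (rule Max_in) auto
  with assms that show ?thesis by auto
qed

lemma gauss_single:
  assumes "\<And>i. w i \<ge> 0"
  shows "gauss w (Poly_Mapping.single m c) = av c * mono_weight w m"
proof (rule antisym)
  show "gauss w (Poly_Mapping.single m c) \<le> av c * mono_weight w m"
    using mono_weight_nonneg[of w, OF assms] av_nonneg
    by (intro gauss_le) (auto simp: lookup_single when_def)
  show "av c * mono_weight w m \<le> gauss w (Poly_Mapping.single m c)"
    using gauss_ge[of "Poly_Mapping.single m c" m w] by simp
qed

lemma gauss_const: "(\<And>i. w i \<ge> 0) \<Longrightarrow> gauss w (mp_const c) = av c"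
  by (simp add: mp_const_def gauss_single mono_weight_def)

lemma gauss_const_var: "(\<And>i. w i \<ge> 0) \<Longrightarrow> gauss w (mp_const c * mp_var i) = av c * w i"
  by (simp add: mp_const_def mp_var_def mult_single gauss_single mono_weight_def)

lemma gauss_add:
  assumes w: "\<And>i. w i \<ge> 0"
  shows "gauss w (g + h) \<le> max (gauss w g) (gauss w h)"
proof (rule gauss_le)
  fix m
  let ?W = "mono_weight w m"
  have "av (Poly_Mapping.lookup (g + h) m) * ?W
      \<le> max (av (Poly_Mapping.lookup g m)) (av (Poly_Mapping.lookup h m)) * ?W"
    using mono_weight_nonneg[of w, OF w] by (auto simp: lookup_add intro!: mult_right_mono av_add)
  also have "\<dots> \<le> max (gauss w g) (gauss w h)"
    using gauss_ge[of g m w] gauss_ge[of h m w] by (auto simp: max_def)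
  finally show "av (Poly_Mapping.lookup (g + h) m) * ?W \<le> max (gauss w g) (gauss w h)" .
qed (simp add: gauss_nonneg le_max_iff_disj)

lemma gauss_sum_le:
  assumes "\<And>i. w i \<ge> 0" "C \<ge> 0" "\<And>i. i \<in> A \<Longrightarrow> gauss w (g i) \<le> C"
  shows "gauss w (sum g A) \<le> C"
  using assms(3)
proof (induction A rule: infinite_finite_induct)
  case (insert i A)
  then show ?case using gauss_add[of w "g i" "sum g A", OF assms(1)] by fastforce
qed (use assms(2) in \<open>auto simp: gauss_def\<close>)

text \<open>The Gauss lemma. For a fixed order of monomials, let \<open>a0\<close> and \<open>b0\<close> be the last monomials whose
  terms attain the maximum in \<open>g\<close> and in \<open>h\<close>. All other contributions to the coefficient of \<open>a0 + b0\<close>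
  in the product contain a factor that lies strictly below its maximum, so the product of these two
  terms dominates and the maximum for \<open>g * h\<close> is not smaller than the product of the maxima.\<close>

lemma gauss_mult:
  fixes g h :: "('i::linorder, 'k) mpoly"
  assumes w: "\<And>i. w i \<ge> 0"
  shows "gauss w (g * h) = gauss w g * gauss w h"
proof (rule antisym)
  define t where "t = (\<lambda>a b. Poly_Mapping.lookup g a * Poly_Mapping.lookup h b)"
  define K where "K = Poly_Mapping.keys g \<times> Poly_Mapping.keys h"
  have fin: "finite K" by (simp add: K_def)
  have wt: "mono_weight w m \<ge> 0" for m
    by (rule mono_weight_nonneg[OF w])
  have split: "av (t a b) * mono_weight w (a + b)
      = (av (Poly_Mapping.lookup g a) * mono_weight w a)
        * (av (Poly_Mapping.lookup h b) * mono_weight w b)" for a b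
    by (simp add: t_def av_mult mono_weight_add mult_ac)
  have lookup: "Poly_Mapping.lookup (g * h) k = (\<Sum>(a, b)\<in>K. if a + b = k then t a b else 0)" for k
    unfolding lookup_times t_def K_def ..
  show "gauss w (g * h) \<le> gauss w g * gauss w h"
  proof (rule gauss_le)
    fix k
    show "av (Poly_Mapping.lookup (g * h) k) * mono_weight w k \<le> gauss w g * gauss w h"
    proof (cases "mono_weight w k = 0")
      case False
      then have pos: "mono_weight w k > 0" using wt[of k] by linarith
      have "av (Poly_Mapping.lookup (g * h) k) \<le> gauss w g * gauss w h / mono_weight w k"
        unfolding lookup
      proof (rule av_sum_le, goal_cases)
        case (2 p)
        obtain a b where p: "p = (a, b)" by force
        have "av (t a b) * mono_weight w (a + b) \<le> gauss w g * gauss w h"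
          unfolding split by (intro mult_mono gauss_ge gauss_nonneg mult_nonneg_nonneg av_nonneg wt)
        then show ?case
          using pos gauss_nonneg by (auto simp: p pos_le_divide_eq intro!: mult_nonneg_nonneg)
      qed (use pos in \<open>auto simp: gauss_nonneg intro!: divide_nonneg_pos mult_nonneg_nonneg\<close>)
      then show ?thesis using pos by (simp add: pos_le_divide_eq)
    qed (auto simp: gauss_nonneg)
  qed (auto simp: gauss_nonneg)
  show "gauss w g * gauss w h \<le> gauss w (g * h)"
  proof (cases "gauss w g = 0 \<or> gauss w h = 0")
    case False
    then have pos: "gauss w g > 0" "gauss w h > 0"
      using gauss_nonneg by (metis order_le_less)+
    have extremal: "\<exists>a0\<in>Poly_Mapping.keys f.
        av (Poly_Mapping.lookup f a0) * mono_weight w a0 = gauss w f \<and>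
        (\<forall>a. a0 < a \<longrightarrow> av (Poly_Mapping.lookup f a) * mono_weight w a < gauss w f)"
      if f: "gauss w f > 0" for f :: "('i, 'k) mpoly"
    proof -
      \<comment> \<open>The monomials whose terms attain the maximum; the last one of them is sought.\<close>
      let ?M = "{a \<in> Poly_Mapping.keys f.
        av (Poly_Mapping.lookup f a) * mono_weight w a = gauss w f}"
      have M: "finite ?M" "?M \<noteq> {}"
        using gauss_attained[OF f] by auto
      have "av (Poly_Mapping.lookup f a) * mono_weight w a < gauss w f" if "Max ?M < a" for a
      proof (rule ccontr)
        assume "\<not> ?thesis"
        then have "av (Poly_Mapping.lookup f a) * mono_weight w a = gauss w f"
          using gauss_ge[of f a w] by simp
        with f have "a \<in> ?M" by (auto simp: in_keys_iff)
        with M that show False using Max_ge leD by blast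
      qed
      with Max_in[OF M] show ?thesis by blast
    qed
    obtain a0 where a0: "a0 \<in> Poly_Mapping.keys g"
      "av (Poly_Mapping.lookup g a0) * mono_weight w a0 = gauss w g"
      "\<And>a. a0 < a \<Longrightarrow> av (Poly_Mapping.lookup g a) * mono_weight w a < gauss w g"
      using extremal[OF pos(1)] by blast
    obtain b0 where b0: "b0 \<in> Poly_Mapping.keys h"
      "av (Poly_Mapping.lookup h b0) * mono_weight w b0 = gauss w h"
      "\<And>b. b0 < b \<Longrightarrow> av (Poly_Mapping.lookup h b) * mono_weight w b < gauss w h"
      using extremal[OF pos(2)] by blast
    have eq: "av (t a0 b0) * mono_weight w (a0 + b0) = gauss w g * gauss w h"
      by (simp add: split a0 b0)
    with pos have t0: "av (t a0 b0) > 0" and W: "mono_weight w (a0 + b0) > 0"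
      using av_nonneg[of "t a0 b0"] wt[of "a0 + b0"]
      by (smt (verit) mult_pos_pos mult_eq_0_iff)+
    define rest where "rest = (\<Sum>(a, b)\<in>K - {(a0, b0)}. if a + b = a0 + b0 then t a b else 0)"
    have sum: "Poly_Mapping.lookup (g * h) (a0 + b0) = t a0 b0 + rest"
      unfolding lookup rest_def
      by (subst sum.remove[of _ "(a0, b0)"]) (use fin a0(1) b0(1) in \<open>auto simp: K_def\<close>)
    have "av rest < av (t a0 b0)"
      unfolding rest_def
    proof (rule av_sum_less[OF t0])
      fix p assume p: "p \<in> K - {(a0, b0)}"
      obtain a b where ab: "p = (a, b)" by force
      have "av (t a b) < av (t a0 b0)" if s: "a + b = a0 + b0"
      proof -
        have "a0 < a \<or> b0 < b"
        proof (rule ccontr)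
          assume "\<not> ?thesis"
          then have "a \<le> a0" "b \<le> b0" by auto
          moreover have "a \<noteq> a0 \<or> b \<noteq> b0" using p ab by auto
          ultimately have "a + b < a0 + b0"
            by (metis add_less_le_mono add_le_less_mono order_le_less)
          with s show False by simp
        qed
        then have "av (t a b) * mono_weight w (a + b) < gauss w g * gauss w h"
        proof
          assume "a0 < a"
          then show ?thesis
            unfolding split using pos wt
            by (intro order.strict_trans1[OF mult_left_mono[OF gauss_ge] mult_strict_right_mono[OF a0(3)]])
              (auto simp: av_nonneg)
        next
          assume "b0 < b"
          then show ?thesis
            unfolding split using pos wt
            by (intro order.strict_trans1[OF mult_right_mono[OF gauss_ge] mult_strict_left_mono[OF b0(3)]])
              (auto simp: av_nonneg)
        qed
        then show ?thesis
          using W by (simp add: s flip: eq)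
      qed
      then show "av (case p of (a, b) \<Rightarrow> if a + b = a0 + b0 then t a b else 0) < av (t a0 b0)"
        using t0 by (auto simp: ab)
    qed
    then have "av (Poly_Mapping.lookup (g * h) (a0 + b0)) = av (t a0 b0)"
      by (simp add: sum av_add_dominant)
    with gauss_ge[of "g * h" "a0 + b0" w] eq show ?thesis by simp
  qed (auto simp: gauss_nonneg)
qed

end

section \<open>Linear forms\<close>

lemma linear_forms_iff:
  "f \<in> linear_forms \<longleftrightarrow> (\<forall>v w. f (v + w) = f v + f w) \<and> (\<forall>c v. f (c *s v) = c * f v)"
  by (simp add: linear_forms_def Vector_Spaces.linear_iff vec.vector_space_axioms
      vector_space_over_itself.vector_space_axioms)

lemma linear_forms_zero [simp]: "(\<lambda>v. 0) \<in> linear_forms"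
  by (simp add: linear_forms_iff)

lemma linear_forms_scale: "f \<in> linear_forms \<Longrightarrow> (\<lambda>v. c * f v) \<in> linear_forms"
  by (simp add: linear_forms_iff algebra_simps)

lemma linear_forms_add: "f \<in> linear_forms \<Longrightarrow> g \<in> linear_forms \<Longrightarrow> (\<lambda>v. f v + g v) \<in> linear_forms"
  by (simp add: linear_forms_iff algebra_simps)

lemma linear_forms_coordinate: "(\<lambda>v. v $ i) \<in> linear_forms"
  by (simp add: linear_forms_iff)

lemma linear_forms_sum:
  "(\<And>i. i \<in> A \<Longrightarrow> f i \<in> linear_forms) \<Longrightarrow> (\<lambda>v. \<Sum>i\<in>A. a i * f i v) \<in> linear_forms"
  by (induction A rule: infinite_finite_induct)
    (auto intro!: linear_forms_add linear_forms_scale)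

lemma linear_forms_expand:
  assumes "f \<in> linear_forms"
  shows "f v = (\<Sum>i\<in>UNIV. f (axis i 1) * v $ i)"
proof -
  have add: "f (v + w) = f v + f w" and scale: "f (c *s v) = c * f v" for v w c
    using assms by (auto simp: linear_forms_iff)
  have 0: "f 0 = 0" using scale[of 0 0] by simp
  have "f (\<Sum>i\<in>A. v $ i *s axis i 1) = (\<Sum>i\<in>A. f (axis i 1) * v $ i)" for A :: "'b set"
    by (induction A rule: infinite_finite_induct) (auto simp: 0 add scale)
  from this[of UNIV] show ?thesis by (simp add: basis_expansion)
qed

lemma form_poly_combination:
  "form_poly (\<lambda>v. \<Sum>i\<in>A. a i * f i v) = (\<Sum>i\<in>A. mp_const (a i) * form_poly (f i))"
proof -
  have "form_poly (\<lambda>v. \<Sum>i\<in>A. a i * f i v)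
      = (\<Sum>j\<in>UNIV. \<Sum>i\<in>A. mp_const (a i) * (mp_const (f i (axis j 1)) * mp_var j))"
    by (simp add: form_poly_def mp_const_sum mp_const_mult sum_distrib_right mult.assoc)
  also have "\<dots> = (\<Sum>i\<in>A. mp_const (a i) * form_poly (f i))"
    by (subst sum.swap) (simp add: form_poly_def sum_distrib_left)
  finally show ?thesis .
qed

lemma form_poly_coordinate: "form_poly (\<lambda>v. v $ j) = mp_var j"
proof -
  have "form_poly (\<lambda>v. v $ j) = (\<Sum>i\<in>UNIV. if i = j then mp_var j else 0)"
    unfolding form_poly_def by (intro sum.cong) (auto simp: axis_def)
  then show ?thesis by simp
qed

lemma homogeneous_form_poly: "homogeneous 1 (form_poly f)"
  unfolding form_poly_def using homogeneous_mult[OF homogeneous_const homogeneous_var]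
  by (intro homogeneous_sum) simp

section \<open>Extending a seminorm on linear forms to a multiplicative seminorm\<close>

lemma nontriv_seminormsD:
  assumes "N \<in> nontriv_seminorms av"
  shows "N \<in> extensional linear_forms"
    and "f \<in> linear_forms \<Longrightarrow> N f \<ge> 0"
    and "f \<in> linear_forms \<Longrightarrow> N (\<lambda>v. c * f v) = av c * N f"
    and "f \<in> linear_forms \<Longrightarrow> g \<in> linear_forms \<Longrightarrow> N (\<lambda>v. f v + g v) \<le> max (N f) (N g)"
    and "\<exists>f\<in>linear_forms. N f \<noteq> 0"
  using assms by (auto simp: nontriv_seminorms_def)

context complete_nonarch_field begin

text \<open>Every finite weighted family of vectors contains a basis of its span in which the weighted coordinates
  of each member \<open>f j\<close> are bounded by the weight of \<open>f j\<close>. If the family is dependent, a relation can be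
  solved for the member whose term has the largest weight in it, and this expresses that member by
  the others with the required bounds. It is discarded, and the bounds compose along the induction.\<close>

lemma reduced_generators:
  fixes f :: "'i \<Rightarrow> 'v \<Rightarrow> 'k" and w :: "'i \<Rightarrow> real"
  assumes "finite S" and w: "\<And>i. w i \<ge> 0"
  obtains B a where "B \<subseteq> S"
    and "\<And>c. (\<And>v. (\<Sum>b\<in>B. c b * f b v) = 0) \<Longrightarrow> \<forall>b\<in>B. c b = 0"
    and "\<And>j v. j \<in> S \<Longrightarrow> f j v = (\<Sum>b\<in>B. a j b * f b v)"
    and "\<And>j b. j \<in> S \<Longrightarrow> b \<in> B \<Longrightarrow> av (a j b) * w b \<le> w j"
proof -
  have "\<exists>B\<subseteq>S. (\<forall>c. (\<forall>v. (\<Sum>b\<in>B. c b * f b v) = 0) \<longrightarrow> (\<forall>b\<in>B. c b = 0)) \<and>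
      (\<forall>j\<in>S. \<exists>a. (\<forall>v. f j v = (\<Sum>b\<in>B. a b * f b v)) \<and> (\<forall>b\<in>B. av (a b) * w b \<le> w j))"
    using assms(1)
  proof (induction S rule: finite_psubset_induct)
    case (psubset S)
    show ?case
    proof (cases "\<forall>c. (\<forall>v. (\<Sum>b\<in>S. c b * f b v) = 0) \<longrightarrow> (\<forall>b\<in>S. c b = 0)")
      case True
      have "\<exists>a. (\<forall>v. f j v = (\<Sum>b\<in>S. a b * f b v)) \<and> (\<forall>b\<in>S. av (a b) * w b \<le> w j)"
        if "j \<in> S" for j
      proof (intro exI conjI allI ballI)
        show "f j v = (\<Sum>b\<in>S. (if b = j then 1 else 0) * f b v)" for v
        proof -
          have "(\<Sum>b\<in>S. (if b = j then 1 else 0) * f b v) = (\<Sum>b\<in>S. if b = j then f b v else 0)"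
            by (intro sum.cong) auto
          with that psubset.hyps show ?thesis by simp
        qed
      qed (auto simp: w)
      then show ?thesis
        by (intro exI[of _ S] conjI ballI True order.refl)
    next
      case False
      then obtain c where c: "\<And>v. (\<Sum>b\<in>S. c b * f b v) = 0" and "\<exists>b\<in>S. c b \<noteq> 0"
        by blast
      then have T: "finite {i \<in> S. c i \<noteq> 0}" "{i \<in> S. c i \<noteq> 0} \<noteq> {}"
        using psubset.hyps by auto
      let ?m = "Max ((\<lambda>i. av (c i) * w i) ` {i \<in> S. c i \<noteq> 0})"
      have "?m \<in> (\<lambda>i. av (c i) * w i) ` {i \<in> S. c i \<noteq> 0}"
        using T by (intro Max_in) auto
      then obtain p where p: "p \<in> S" "c p \<noteq> 0" and m: "?m = av (c p) * w p"
        by auto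
      have max: "av (c i) * w i \<le> av (c p) * w p" if "i \<in> S" "c i \<noteq> 0" for i
        unfolding m[symmetric] using T that by (intro Max_ge) auto
      define d where "d = (\<lambda>i. - c i / c p)"
      have fp: "f p v = (\<Sum>i\<in>S - {p}. d i * f i v)" for v
      proof -
        have "c p * f p v + (\<Sum>i\<in>S - {p}. c i * f i v) = 0"
          using c[of v] p psubset.hyps by (simp add: sum.remove)
        then have "f p v = - (\<Sum>i\<in>S - {p}. c i * f i v) / c p"
          using p by (simp add: field_simps add_eq_0_iff)
        then show ?thesis
          by (simp add: d_def sum_divide_distrib sum_negf)
      qed
      have d: "av (d i) * w i \<le> w p" if "i \<in> S" for i
      proof (cases "c i = 0")
        case False
        with max[OF that] p(2) show ?thesis
          by (simp add: d_def av_divide av_pos field_simps)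
      qed (simp add: d_def w)
      \<comment> \<open>The index \<open>p\<close> with the largest term of the relation is redundant.\<close>
      have "S - {p} \<subset> S" using p by auto
      from psubset.IH[OF this] obtain B where B: "B \<subseteq> S - {p}"
        and indep: "\<forall>c. (\<forall>v. (\<Sum>b\<in>B. c b * f b v) = 0) \<longrightarrow> (\<forall>b\<in>B. c b = 0)"
        and ex: "\<forall>j\<in>S - {p}. \<exists>a. (\<forall>v. f j v = (\<Sum>b\<in>B. a b * f b v)) \<and> (\<forall>b\<in>B. av (a b) * w b \<le> w j)"
        by (elim exE conjE)
      obtain a where a: "\<And>j v. j \<in> S - {p} \<Longrightarrow> f j v = (\<Sum>b\<in>B. a j b * f b v)"
        and aw: "\<And>j b. j \<in> S - {p} \<Longrightarrow> b \<in> B \<Longrightarrow> av (a j b) * w b \<le> w j"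
        using bchoice[OF ex] by (elim exE) simp
      have "\<exists>a. (\<forall>v. f p v = (\<Sum>b\<in>B. a b * f b v)) \<and> (\<forall>b\<in>B. av (a b) * w b \<le> w p)"
      proof (intro exI conjI allI ballI)
        fix v
        have "f p v = (\<Sum>i\<in>S - {p}. \<Sum>b\<in>B. d i * a i b * f b v)"
          unfolding fp by (intro sum.cong) (auto simp: a sum_distrib_left mult.assoc)
        also have "\<dots> = (\<Sum>b\<in>B. (\<Sum>i\<in>S - {p}. d i * a i b) * f b v)"
          by (subst sum.swap) (simp add: sum_distrib_right)
        finally show "f p v = (\<Sum>b\<in>B. (\<Sum>i\<in>S - {p}. d i * a i b) * f b v)" .
      next
        fix b assume b: "b \<in> B"
        show "av (\<Sum>i\<in>S - {p}. d i * a i b) * w b \<le> w p"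
        proof (cases "w b = 0")
          case False
          then have wb: "w b > 0" using w[of b] by linarith
          have "av (\<Sum>i\<in>S - {p}. d i * a i b) \<le> w p / w b"
          proof (rule av_sum_le)
            fix i assume i: "i \<in> S - {p}"
            have "av (d i) * (av (a i b) * w b) \<le> av (d i) * w i"
              by (intro mult_left_mono aw i b av_nonneg)
            also have "\<dots> \<le> w p" using d i by auto
            finally show "av (d i * a i b) \<le> w p / w b"
              using wb by (simp add: pos_le_divide_eq av_mult mult.assoc)
          qed (use w wb in auto)
          then show ?thesis using wb by (simp add: pos_le_divide_eq)
        qed (simp add: w)
      qed
      then have "\<exists>a. (\<forall>v. f j v = (\<Sum>b\<in>B. a b * f b v)) \<and> (\<forall>b\<in>B. av (a b) * w b \<le> w j)"
        if "j \<in> S" for j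
      proof (cases "j = p")
        case False
        with that a aw show ?thesis by (intro exI[of _ "a j"]) simp
      qed simp
      moreover have "B \<subseteq> S" using B by blast
      ultimately show ?thesis using indep by (intro exI[of _ B] conjI ballI)
    qed
  qed
  then obtain B where B: "B \<subseteq> S"
    and indep: "\<forall>c. (\<forall>v. (\<Sum>b\<in>B. c b * f b v) = 0) \<longrightarrow> (\<forall>b\<in>B. c b = 0)"
    and "\<forall>j\<in>S. \<exists>a. (\<forall>v. f j v = (\<Sum>b\<in>B. a b * f b v)) \<and> (\<forall>b\<in>B. av (a b) * w b \<le> w j)"
    by blast
  from this(3) obtain a where "\<forall>j\<in>S. (\<forall>v. f j v = (\<Sum>b\<in>B. a j b * f b v)) \<and> (\<forall>b\<in>B. av (a j b) * w b \<le> w j)"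
    by (rule bchoice[THEN exE])
  with B indep show ?thesis by (intro that[of B a]) simp_all
qed

lemma seminorm_combination_le:
  assumes N: "N \<in> nontriv_seminorms av" and f: "\<And>i. i \<in> A \<Longrightarrow> f i \<in> linear_forms"
    and C: "C \<ge> 0" "\<And>i. i \<in> A \<Longrightarrow> av (a i) * N (f i) \<le> C"
  shows "N (\<lambda>v. \<Sum>i\<in>A. a i * f i v) \<le> C"
proof -
  have 0: "N (\<lambda>v. 0) = 0"
    using nontriv_seminormsD(3)[OF N linear_forms_zero, of 0] by simp
  show ?thesis
    using f C(2)
  proof (induction A rule: infinite_finite_induct)
    case (insert i A)
    have "N (\<lambda>v. a i * f i v + (\<Sum>i\<in>A. a i * f i v))
        \<le> max (N (\<lambda>v. a i * f i v)) (N (\<lambda>v. \<Sum>i\<in>A. a i * f i v))"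
      using insert by (intro nontriv_seminormsD(4)[OF N] linear_forms_scale linear_forms_sum) auto
    also have "\<dots> \<le> C"
      using insert by (auto simp: nontriv_seminormsD(3)[OF N])
    finally show ?case using insert.hyps by simp
  qed (use C 0 in auto)
qed

lemma seminorm_nonzero_on_generators:
  fixes N :: "('k ^ 'n \<Rightarrow> 'k) \<Rightarrow> real"
  assumes N: "N \<in> nontriv_seminorms av" and f: "spanning_forms n f"
  shows "\<exists>i\<le>n. N (f i) \<noteq> 0"
proof (rule ccontr)
  assume 0: "\<not> ?thesis"
  obtain g where g: "g \<in> linear_forms" "N g \<noteq> 0"
    using nontriv_seminormsD(5)[OF N] by blast
  with f obtain a where a: "g = (\<lambda>v. \<Sum>i\<le>n. a i * f i v)"
    by (auto simp: spanning_forms_def)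
  have "N g \<le> 0"
    unfolding a using 0 f by (intro seminorm_combination_le[OF N]) (auto simp: spanning_forms_def)
  with g nontriv_seminormsD(2)[OF N g(1)] show False by simp
qed

text \<open>Let \<open>f b\<close>, \<open>b \<in> B\<close>, be a reduced basis for the weights \<open>N (f i)\<close>. The coordinate ring of projective
  space is the polynomial ring in the variables \<open>f b\<close>, and the Gauss seminorm with weights \<open>N (f b)\<close>
  on it is the required extension. Its value at \<open>f j\<close> is at most \<open>N (f j)\<close> because the basis is reduced,
  and at least \<open>N (f j)\<close> because \<open>N\<close> is ultrametric. Being pulled back from the coordinate ring, it
  vanishes on the ideal of the image.\<close>

lemma seminorm_extends:
  fixes N :: "('k ^ 'n::finite \<Rightarrow> 'k) \<Rightarrow> real"
  assumes N: "N \<in> nontriv_seminorms av" and f: "spanning_forms n f"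
  obtains x where "x \<in> mult_seminorms av n"
    and "\<And>i. i \<le> n \<Longrightarrow> x (mp_var i) = N (f i)"
    and "\<And>g. g \<in> mpolys {..n} \<Longrightarrow> mp_subst (\<lambda>i. form_poly (f i)) g = 0 \<Longrightarrow> x g = 0"
proof -
  define w where "w = (\<lambda>i. if i \<le> n then N (f i) else 0)"
  have lin: "f i \<in> linear_forms" if "i \<le> n" for i
    using f that by (auto simp: spanning_forms_def)
  have w: "w i \<ge> 0" for i
    using nontriv_seminormsD(2)[OF N lin] by (simp add: w_def)
  obtain B a where B: "B \<subseteq> {..n}"
    and indep: "\<And>c. (\<And>v. (\<Sum>b\<in>B. c b * f b v) = 0) \<Longrightarrow> \<forall>b\<in>B. c b = 0"
    and a: "\<And>j v. j \<in> {..n} \<Longrightarrow> f j v = (\<Sum>b\<in>B. a j b * f b v)"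
    and aw: "\<And>j b. j \<in> {..n} \<Longrightarrow> b \<in> B \<Longrightarrow> av (a j b) * w b \<le> w j"
    using reduced_generators[of "{..n}" w f] w by blast
  have finB: "finite B" using B finite_subset by blast
  have "\<exists>c. \<forall>v. v $ i = (\<Sum>b\<in>B. c b * f b v)" for i :: 'n
  proof -
    obtain c where c: "(\<lambda>v. v $ i) = (\<lambda>v. \<Sum>j\<le>n. c j * f j v)"
      using f linear_forms_coordinate[of i] by (auto simp: spanning_forms_def)
    have "v $ i = (\<Sum>b\<in>B. (\<Sum>j\<le>n. c j * a j b) * f b v)" for v
    proof -
      have "v $ i = (\<Sum>j\<le>n. \<Sum>b\<in>B. c j * a j b * f b v)"
        unfolding fun_cong[OF c] by (intro sum.cong) (auto simp: a sum_distrib_left mult.assoc)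
      then show ?thesis
        by (subst (asm) sum.swap) (simp add: sum_distrib_right)
    qed
    then show ?thesis by (intro exI allI)
  qed
  then obtain c where c: "\<And>i v. v $ i = (\<Sum>b\<in>B. c i b * f b v)" for i :: 'n and v :: "'k ^ 'n"
    by metis
  \<comment> \<open>The coordinate \<open>i\<close> of projective space, written in the variables that stand for the basis.\<close>
  define \<tau> where "\<tau> = (\<lambda>i::'n. \<Sum>b\<in>B. mp_const (c i b) * (mp_var b :: (nat, 'k) mpoly))"
  have \<tau>: "mp_subst \<tau> (form_poly (f j)) = (\<Sum>b\<in>B. mp_const (a j b) * mp_var b)" if "j \<le> n" for j
  proof -
    define e where "e = (\<lambda>b. \<Sum>i\<in>UNIV. f j (axis i 1) * c i b)"
    have "mp_subst \<tau> (form_poly (f j))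
        = (\<Sum>i\<in>UNIV. \<Sum>b\<in>B. mp_const (f j (axis i 1) * c i b) * mp_var b)"
      by (simp add: form_poly_def mp_subst_sum mp_subst_mult \<tau>_def sum_distrib_left mp_const_mult mult.assoc)
    also have "\<dots> = (\<Sum>b\<in>B. mp_const (e b) * mp_var b)"
      by (subst sum.swap) (simp add: e_def mp_const_sum sum_distrib_right)
    also have "\<dots> = (\<Sum>b\<in>B. mp_const (a j b) * mp_var b)"
    proof (rule sum.cong[OF refl])
      have "(\<Sum>b\<in>B. (e b - a j b) * f b v) = 0" for v
      proof -
        have "f j v = (\<Sum>i\<in>UNIV. \<Sum>b\<in>B. f j (axis i 1) * c i b * f b v)"
          by (subst linear_forms_expand[OF lin[OF that]]) (simp add: c[of v] sum_distrib_left mult.assoc)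
        also have "\<dots> = (\<Sum>b\<in>B. e b * f b v)"
          by (subst sum.swap) (simp add: e_def sum_distrib_right)
        finally show ?thesis
          using a[of j v] that by (simp add: left_diff_distrib sum_subtractf)
      qed
      from indep[OF this] show "mp_const (e b) * mp_var b = mp_const (a j b) * mp_var b"
        if "b \<in> B" for b using that by simp
    qed
    finally show ?thesis .
  qed
  define x where "x = restrict (\<lambda>g. gauss w (mp_subst \<tau> (mp_subst (\<lambda>i. form_poly (f i)) g))) (mpolys {..n})"
  have var: "x (mp_var j) = N (f j)" if j: "j \<le> n" for j
  proof -
    let ?l = "\<Sum>b\<in>B. mp_const (a j b) * mp_var b :: (nat, 'k) mpoly"
    have "x (mp_var j) = gauss w ?l"
      using j by (simp add: x_def mpolys_var \<tau>)
    moreover have "gauss w ?l \<le> w j"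
      using aw j by (intro gauss_sum_le) (auto simp: w gauss_const_var)
    moreover have "N (f j) \<le> gauss w ?l"
    proof -
      have "N (\<lambda>v. \<Sum>b\<in>B. a j b * f b v) \<le> gauss w ?l"
      proof (rule seminorm_combination_le[OF N _ gauss_nonneg])
        fix b assume b: "b \<in> B"
        show "f b \<in> linear_forms" using B b lin by auto
        have "Poly_Mapping.lookup ?l (Poly_Mapping.single b 1) = a j b"
        proof -
          have "Poly_Mapping.lookup ?l (Poly_Mapping.single b 1) = (\<Sum>b'\<in>B. if b' = b then a j b' else 0)"
            unfolding lookup_sum
            by (intro sum.cong)
              (auto simp: mp_const_def mp_var_def mult_single lookup_single when_def
                dest: arg_cong[of _ _ Poly_Mapping.keys])
          with b finB show ?thesis by simp
        qed
        with gauss_ge[of ?l "Poly_Mapping.single b 1" w] B b show "av (a j b) * N (f b) \<le> gauss w ?l"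
          by (auto simp: mono_weight_def w_def)
      qed
      moreover have "f j = (\<lambda>v. \<Sum>b\<in>B. a j b * f b v)"
        using a j by auto
      ultimately show ?thesis by simp
    qed
    ultimately show ?thesis using j by (simp add: w_def)
  qed
  show thesis
  proof
    obtain i where "i \<le> n" "N (f i) \<noteq> 0"
      using seminorm_nonzero_on_generators[OF N f] by blast
    with var have "\<exists>i\<le>n. x (mp_var i) \<noteq> 0" by metis
    moreover have "x \<in> extensional (mpolys {..n})"
      by (simp add: x_def)
    ultimately show "x \<in> mult_seminorms av n"
      unfolding mult_seminorms_def
      by (simp add: x_def gauss_nonneg gauss_const[OF w] gauss_mult[OF w] gauss_add[OF w]
          mp_subst_mult mp_subst_add mpolys_mult mpolys_add)
    show "x g = 0" if "g \<in> mpolys {..n}" "mp_subst (\<lambda>i. form_poly (f i)) g = 0" for g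
      using that by (simp add: x_def gauss_def)
  qed (fact var)
qed

end

section \<open>Tropical projective space in multiplicative coordinates\<close>

lemma trop_translation_equiv: "equiv (trop_vectors n) (trop_translation n)"
proof (rule equivI)
  show "trop_translation n \<subseteq> trop_vectors n \<times> trop_vectors n"
    by (auto simp: trop_translation_def)
  show "refl_on (trop_vectors n) (trop_translation n)"
    by (auto simp: refl_on_def trop_translation_def intro!: exI[of _ "0::real"])
  show "sym (trop_translation n)"
  proof (rule symI)
    fix u u' assume "(u, u') \<in> trop_translation n"
    then obtain c where c: "\<forall>i\<le>n. u' i = u i + ereal c" and u: "u \<in> trop_vectors n" "u' \<in> trop_vectors n"
      by (auto simp: trop_translation_def)
    have "u i = u' i + ereal (- c)" if "i \<le> n" for i
      using c that by (cases "u i") auto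
    with u show "(u', u) \<in> trop_translation n"
      unfolding trop_translation_def by blast
  qed
  show "trans (trop_translation n)"
  proof (rule transI)
    fix u u' u'' assume "(u, u') \<in> trop_translation n" "(u', u'') \<in> trop_translation n"
    then obtain c c' where c: "\<forall>i\<le>n. u' i = u i + ereal c" "\<forall>i\<le>n. u'' i = u' i + ereal c'"
      and u: "u \<in> trop_vectors n" "u'' \<in> trop_vectors n"
      unfolding trop_translation_def by blast
    have "u'' i = u i + ereal (c + c')" if "i \<le> n" for i
      using c that by (simp add: add.assoc)
    with u show "(u, u'') \<in> trop_translation n"
      unfolding trop_translation_def by blast
  qed
qed

lemma neg_log_neq_minf [simp]: "neg_log a \<noteq> -\<infinity>"
  by (simp add: neg_log_def)

lemma neg_log_eq_inf_iff [simp]: "neg_log a = \<infinity> \<longleftrightarrow> a = 0"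
  by (simp add: neg_log_def)

lemma neg_log_translate_iff:
  assumes "a \<ge> 0" "b \<ge> 0"
  shows "neg_log b = neg_log a + ereal c \<longleftrightarrow> b = exp (- c) * a"
proof (cases "a = 0 \<or> b = 0")
  case False
  with assms have pos: "a > 0" "b > 0" by auto
  have "b = exp (- c) * a \<longleftrightarrow> ln b = ln (exp (- c) * a)"
    using pos by (subst ln_inj_iff) auto
  also have "\<dots> \<longleftrightarrow> ln b = - c + ln a"
    using pos by (simp add: ln_mult)
  finally show ?thesis
    using pos by (auto simp: neg_log_def)
qed (auto simp: neg_log_def)

text \<open>Tropical points are handled through their exponentials: a family of nonnegative reals that are
  not all zero, up to a positive factor.\<close>

definition projective_coords :: "nat \<Rightarrow> (nat \<Rightarrow> real) \<Rightarrow> bool" where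
  "projective_coords n a \<longleftrightarrow> (\<forall>i\<le>n. a i \<ge> 0) \<and> (\<exists>i\<le>n. a i \<noteq> 0)"

definition trop_coords :: "nat \<Rightarrow> (nat \<Rightarrow> real) \<Rightarrow> (nat \<Rightarrow> ereal) set" where
  "trop_coords n a = trop_point n (\<lambda>i. neg_log (a i))"

lemma neg_log_trop_vectors:
  "projective_coords n a \<Longrightarrow> (\<lambda>i\<in>{..n}. neg_log (a i)) \<in> trop_vectors n"
  by (auto simp: projective_coords_def trop_vectors_def)

lemma trop_coords_mem: "projective_coords n a \<Longrightarrow> (\<lambda>i\<in>{..n}. neg_log (a i)) \<in> trop_coords n a"
  unfolding trop_coords_def trop_point_def
  by (intro equiv_class_self[OF trop_translation_equiv] neg_log_trop_vectors)

lemma trop_coords_eq_iff: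
  assumes "projective_coords n a" "projective_coords n b"
  shows "trop_coords n a = trop_coords n b \<longleftrightarrow> (\<exists>c>0. \<forall>i\<le>n. b i = c * a i)"
proof -
  have "trop_coords n a = trop_coords n b \<longleftrightarrow>
      ((\<lambda>i\<in>{..n}. neg_log (a i)), (\<lambda>i\<in>{..n}. neg_log (b i))) \<in> trop_translation n"
    unfolding trop_coords_def trop_point_def
    by (rule eq_equiv_class_iff[OF trop_translation_equiv]) (intro neg_log_trop_vectors assms)+
  also have "\<dots> \<longleftrightarrow> (\<exists>c. \<forall>i\<le>n. neg_log (b i) = neg_log (a i) + ereal c)"
    using neg_log_trop_vectors assms by (auto simp: trop_translation_def)
  also have "\<dots> \<longleftrightarrow> (\<exists>c. \<forall>i\<le>n. b i = exp (- c) * a i)"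
    using assms by (simp add: neg_log_translate_iff projective_coords_def)
  also have "\<dots> \<longleftrightarrow> (\<exists>c>0. \<forall>i\<le>n. b i = c * a i)"
  proof
    assume "\<exists>c>0. \<forall>i\<le>n. b i = c * a i"
    then obtain c where "c > 0" "\<forall>i\<le>n. b i = c * a i" by blast
    then have "\<forall>i\<le>n. b i = exp (- (- ln c)) * a i" by simp
    then show "\<exists>c. \<forall>i\<le>n. b i = exp (- c) * a i" by blast
  qed (metis exp_gt_zero)
  finally show ?thesis .
qed

lemma trop_coords_eqI:
  assumes "projective_coords n a" "c > 0" "\<And>i. i \<le> n \<Longrightarrow> b i = c * a i"
  shows "trop_coords n b = trop_coords n a"
proof -
  have "projective_coords n b"
    using assms by (auto simp: projective_coords_def)
  with assms trop_coords_eq_iff show ?thesis by metis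
qed

lemma trop_transition_coords:
  assumes a: "projective_coords n a" and \<sigma>: "\<And>j. j \<le> n' \<Longrightarrow> \<sigma> j \<le> n"
    and b: "projective_coords n' (\<lambda>j. a (\<sigma> j))"
  shows "trop_transition (n', \<iota>', U') \<sigma> (trop_coords n a) = trop_coords n' (\<lambda>j. a (\<sigma> j))"
proof -
  have *: "trop_point n' (\<lambda>j. u (\<sigma> j)) = trop_coords n' (\<lambda>j. a (\<sigma> j))" if u: "u \<in> trop_coords n a" for u
  proof -
    let ?v = "\<lambda>j\<in>{..n'}. neg_log (a (\<sigma> j))"
    obtain c where c: "\<And>i. i \<le> n \<Longrightarrow> u i = neg_log (a i) + ereal c"
      using u by (auto simp: trop_coords_def trop_point_def trop_translation_def)
    have v: "?v \<in> trop_vectors n'"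
      by (rule neg_log_trop_vectors[OF b])
    have "(\<lambda>j\<in>{..n'}. u (\<sigma> j)) \<in> trop_vectors n'"
      using b by (auto simp: trop_vectors_def c \<sigma> projective_coords_def)
    with v have "(?v, \<lambda>j\<in>{..n'}. u (\<sigma> j)) \<in> trop_translation n'"
      by (auto simp: trop_translation_def c \<sigma>)
    from equiv_class_eq[OF trop_translation_equiv this] show ?thesis
      by (simp add: trop_point_def trop_coords_def)
  qed
  show ?thesis
    using trop_coords_mem[OF a] by (auto simp: *)
qed

section \<open>Tropicalizations consist of values of seminorms on linear forms\<close>

context complete_nonarch_field begin

lemma spanning_linear: "spanning_forms n f \<Longrightarrow> i \<le> n \<Longrightarrow> f i \<in> linear_forms"
  by (auto simp: spanning_forms_def)

lemma projective_coords_seminorm: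
  fixes N :: "('k ^ 'n \<Rightarrow> 'k) \<Rightarrow> real"
  assumes "N \<in> nontriv_seminorms av" "spanning_forms n f"
  shows "projective_coords n (\<lambda>i. N (f i))"
  unfolding projective_coords_def
  using seminorm_nonzero_on_generators[OF assms] nontriv_seminormsD(2)[OF assms(1)]
    spanning_linear[OF assms(2)] by blast

lemma linear_map_class_self:
  "spanning_forms n f \<Longrightarrow> f \<in> linear_map_class n f"
  unfolding linear_map_class_def
  by (intro CollectI exI[of _ 1])
    (auto simp: spanning_forms_def PiE_def extensional_def restrict_def)

lemma mult_seminormsD:
  assumes "x \<in> mult_seminorms av n"
  shows "g \<in> mpolys {..n} \<Longrightarrow> x g \<ge> 0"
    and "x (mp_const c) = av c"
    and "g \<in> mpolys {..n} \<Longrightarrow> h \<in> mpolys {..n} \<Longrightarrow> x (g * h) = x g * x h"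
    and "g \<in> mpolys {..n} \<Longrightarrow> h \<in> mpolys {..n} \<Longrightarrow> x (g + h) \<le> max (x g) (x h)"
    and "\<exists>i\<le>n. x (mp_var i) \<noteq> 0"
  using assms by (auto simp: mult_seminorms_def)

lemma mult_seminorm_sum_le:
  assumes x: "x \<in> mult_seminorms av n" and g: "\<And>i. i \<in> A \<Longrightarrow> g i \<in> mpolys {..n}"
    and C: "C \<ge> 0" "\<And>i. i \<in> A \<Longrightarrow> x (g i) \<le> C"
  shows "x (sum g A) \<le> C"
  using g C(2)
proof (induction A rule: infinite_finite_induct)
  case (insert i A)
  then have "x (g i + sum g A) \<le> max (x (g i)) (x (sum g A))"
    by (intro mult_seminormsD(4)[OF x] mpolys_sum) auto
  with insert show ?case by fastforce
qed (use mult_seminormsD(2)[OF x, of 0] C(1) in auto)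

lemma projective_coords_mult_seminorm:
  "x \<in> mult_seminorms av n \<Longrightarrow> projective_coords n (\<lambda>i. x (mp_var i))"
  unfolding projective_coords_def
  by (intro conjI allI impI) (auto intro: mult_seminormsD(1) mpolys_var mult_seminormsD(5))

lemma analytic_equiv_refl: "x \<in> mult_seminorms av n \<Longrightarrow> (x, x) \<in> analytic_equiv av n"
  by (auto simp: analytic_equiv_def intro!: exI[of _ "1::real"])

text \<open>Equivalent multiplicative seminorms differ by a common factor on all variables, so every
  representative yields the same tropical point.\<close>

lemma trop_map_class:
  assumes x: "x \<in> mult_seminorms av n"
  shows "trop_map n (analytic_equiv av n `` {x}) = trop_coords n (\<lambda>i. x (mp_var i))"
proof -
  have "trop_coords n (\<lambda>i. y (mp_var i)) = trop_coords n (\<lambda>i. x (mp_var i))"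
    if "(x, y) \<in> analytic_equiv av n" for y
  proof -
    obtain c where c: "c > 0" "\<And>d g. g \<in> mpolys {..n} \<Longrightarrow> homogeneous d g \<Longrightarrow> y g = c ^ d * x g"
      using \<open>(x, y) \<in> analytic_equiv av n\<close> by (auto simp: analytic_equiv_def)
    have "y (mp_var i) = c * x (mp_var i)" if "i \<le> n" for i
      using c(2)[OF mpolys_var homogeneous_var] that by simp
    with c(1) show ?thesis
      by (intro trop_coords_eqI[of _ _ c] projective_coords_mult_seminorm[OF x])
  qed
  then have "trop_map n (analytic_equiv av n `` {x})
      = (\<Union>y\<in>analytic_equiv av n `` {x}. trop_coords n (\<lambda>i. x (mp_var i)))"
    unfolding trop_map_def trop_coords_def by (intro SUP_cong refl) blast
  with analytic_equiv_refl[OF x] show ?thesis by auto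
qed

text \<open>Equivalence controls a representative only on homogeneous polynomials. The ideal of the image is
  homogeneous, and an ultrametric seminorm that vanishes on all homogeneous components of a polynomial
  vanishes on the polynomial.\<close>

lemma image_analytification_class:
  fixes \<iota> :: "(nat \<Rightarrow> 'k ^ 'n::finite \<Rightarrow> 'k) set"
  assumes x: "x \<in> mult_seminorms av n" and 0: "\<And>g. g \<in> image_ideal n \<iota> \<Longrightarrow> x g = 0"
  shows "analytic_equiv av n `` {x} \<in> image_analytification av n \<iota>"
  unfolding image_analytification_def
proof (intro CollectI conjI ballI)
  show "analytic_equiv av n `` {x} \<in> proj_analytification av n"
    unfolding proj_analytification_def by (rule quotientI[OF x])
  fix y g assume "y \<in> analytic_equiv av n `` {x}" and g: "g \<in> image_ideal n \<iota>"
  then obtain c where y: "y \<in> mult_seminorms av n"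
    and c: "\<And>d g. g \<in> mpolys {..n} \<Longrightarrow> homogeneous d g \<Longrightarrow> y g = c ^ d * x g"
    by (auto simp: analytic_equiv_def)
  have mp: "hom_component d g \<in> mpolys {..n}" for d
    using g by (simp add: image_ideal_def hom_component_mpolys)
  have "hom_component d g \<in> image_ideal n \<iota>" for d
  proof -
    have "mp_subst (\<lambda>i. form_poly (f i)) (hom_component d g) = (0 :: ('n, 'k) mpoly)" if "f \<in> \<iota>" for f
      using g that hom_component_subst[of "\<lambda>i. form_poly (f i)" d g, OF homogeneous_form_poly]
      by (simp add: image_ideal_def hom_component_def[of d 0])
    with mp show ?thesis by (simp add: image_ideal_def)
  qed
  then have "y (hom_component d g) = 0" for d
    using c[OF mp homogeneous_hom_component] 0 by simp
  then have "y (\<Sum>d\<in>mono_degree ` Poly_Mapping.keys g. hom_component d g) \<le> 0"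
    by (intro mult_seminorm_sum_le[OF y]) (auto simp: mp)
  then show "y g = 0"
    using mult_seminormsD(1)[OF y, of g] g by (simp add: sum_hom_components image_ideal_def)
qed

lemma trop_of_seminorm:
  fixes N :: "('k ^ 'n::finite \<Rightarrow> 'k) \<Rightarrow> real"
  assumes N: "N \<in> nontriv_seminorms av" and f: "spanning_forms n f"
  shows "trop_coords n (\<lambda>i. N (f i)) \<in> trop_map n ` image_analytification av n (linear_map_class n f)"
proof -
  obtain x where x: "x \<in> mult_seminorms av n" and var: "\<And>i. i \<le> n \<Longrightarrow> x (mp_var i) = N (f i)"
    and 0: "\<And>g. g \<in> mpolys {..n} \<Longrightarrow> mp_subst (\<lambda>i. form_poly (f i)) g = 0 \<Longrightarrow> x g = 0"
    using seminorm_extends[OF N f] by blast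
  have "trop_coords n (\<lambda>i. N (f i)) = trop_map n (analytic_equiv av n `` {x})"
    unfolding trop_map_class[OF x]
    by (rule trop_coords_eqI[of _ _ 1]) (auto simp: projective_coords_mult_seminorm[OF x] var)
  moreover have "x g = 0" if "g \<in> image_ideal n (linear_map_class n f)" for g
    using that linear_map_class_self[OF f] by (auto simp: image_ideal_def intro: 0)
  ultimately show ?thesis
    using image_analytification_class[OF x] by blast
qed

text \<open>A combination of the variables that represents the zero form lies in the ideal of the image.
  Hence the value of a multiplicative seminorm at \<open>\<Sum> a\<^sub>i t\<^sub>i\<close> depends only on the form \<open>\<Sum> a\<^sub>i f\<^sub>i\<close>, and
  restricting to linear polynomials yields a seminorm on linear forms.\<close>

lemma seminorm_of_trop:
  fixes f :: "nat \<Rightarrow> 'k ^ 'n::finite \<Rightarrow> 'k"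
  assumes f: "spanning_forms n f"
    and p: "p \<in> trop_map n ` image_analytification av n (linear_map_class n f)"
  obtains N where "N \<in> nontriv_seminorms av" "p = trop_coords n (\<lambda>i. N (f i))"
proof -
  obtain q where q: "q \<in> image_analytification av n (linear_map_class n f)" "p = trop_map n q"
    using p by blast
  then obtain x where x: "x \<in> mult_seminorms av n" and q_eq: "q = analytic_equiv av n `` {x}"
    by (auto simp: image_analytification_def proj_analytification_def elim!: quotientE)
  have ideal: "x g = 0" if "g \<in> image_ideal n (linear_map_class n f)" for g
    using q(1) that analytic_equiv_refl[OF x] by (auto simp: image_analytification_def q_eq)
  define L where "L = (\<lambda>a. \<Sum>i\<le>n. mp_const (a i) * (mp_var i :: (nat, 'k) mpoly))"
  have L: "L a \<in> mpolys {..n}" for a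
    unfolding L_def by (intro mpolys_sum mpolys_mult mpolys_const mpolys_var) auto
  have kernel: "x (L a) = 0" if a: "\<And>v. (\<Sum>i\<le>n. a i * f i v) = 0" for a
  proof (rule ideal)
    have "mp_subst (\<lambda>i. form_poly (f' i)) (L a) = 0" if f': "f' \<in> linear_map_class n f" for f'
    proof -
      obtain c where c: "f' = (\<lambda>i\<in>{..n}. \<lambda>v. c * f i v)"
        using f' by (auto simp: linear_map_class_def)
      have "mp_subst (\<lambda>i. form_poly (f' i)) (L a) = (\<Sum>i\<le>n. mp_const (a i) * form_poly (f' i))"
        by (simp add: L_def mp_subst_sum mp_subst_mult)
      also have "\<dots> = form_poly (\<lambda>v. \<Sum>i\<le>n. a i * f' i v)"
        by (rule form_poly_combination[symmetric])
      also have "(\<lambda>v. \<Sum>i\<le>n. a i * f' i v) = (\<lambda>v. c * (\<Sum>i\<le>n. a i * f i v))"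
        by (simp add: c sum_distrib_left mult_ac)
      finally show ?thesis
        by (simp add: a form_poly_def)
    qed
    with L show "L a \<in> image_ideal n (linear_map_class n f)"
      by (simp add: image_ideal_def)
  qed
  have L_add: "L (\<lambda>i. a i + b i) = L a + L b" for a b
    by (simp add: L_def mp_const_add distrib_right sum.distrib)
  have L_scale: "L (\<lambda>i. c * a i) = mp_const c * L a" for a c
    by (simp add: L_def mp_const_mult sum_distrib_left mult.assoc)
  have le: "x (L a) \<le> x (L b)" if "\<And>v. (\<Sum>i\<le>n. a i * f i v) = (\<Sum>i\<le>n. b i * f i v)" for a b
  proof -
    have "x (L (\<lambda>i. a i - b i)) = 0"
      using that by (intro kernel) (simp add: left_diff_distrib sum_subtractf)
    moreover have "x (L (\<lambda>i. (a i - b i) + b i)) \<le> max (x (L (\<lambda>i. a i - b i))) (x (L b))"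
      unfolding L_add by (rule mult_seminormsD(4)[OF x L L])
    ultimately show ?thesis
      using mult_seminormsD(1)[OF x L] by simp
  qed
  have well_def: "x (L a) = x (L b)" if "\<And>v. (\<Sum>i\<le>n. a i * f i v) = (\<Sum>i\<le>n. b i * f i v)" for a b
    using that by (intro antisym le) auto
  have "\<forall>g\<in>linear_forms. \<exists>a. g = (\<lambda>v. \<Sum>i\<le>n. a i * f i v)"
    using f by (simp add: spanning_forms_def)
  from bchoice[OF this] obtain coeffs
    where coeffs: "\<And>g. g \<in> linear_forms \<Longrightarrow> g = (\<lambda>v. \<Sum>i\<le>n. coeffs g i * f i v)" by blast
  define N where "N = restrict (\<lambda>g. x (L (coeffs g))) linear_forms"
  have N: "N g = x (L a)" if "g \<in> linear_forms" "\<And>v. g v = (\<Sum>i\<le>n. a i * f i v)" for g a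
  proof -
    have "x (L (coeffs g)) = x (L a)"
      using coeffs[OF that(1)] that(2) by (intro well_def) metis
    then show ?thesis by (simp add: N_def that(1))
  qed
  have N_f: "N (f j) = x (mp_var j)" if "j \<le> n" for j
  proof -
    have "f j v = (\<Sum>i\<le>n. (if i = j then 1 else 0) * f i v)" for v
      using that by (simp add: if_distrib[of "\<lambda>c. c * _"] cong: if_cong)
    moreover have "L (\<lambda>i. if i = j then 1 else 0) = mp_var j"
      using that by (simp add: L_def if_distrib[of "\<lambda>c. mp_const c * _"] cong: if_cong)
    ultimately show ?thesis
      using N[OF spanning_linear[OF f that], of "\<lambda>i. if i = j then 1 else 0"] by simp
  qed
  have lin: "g v = (\<Sum>i\<le>n. coeffs g i * f i v)" if "g \<in> linear_forms" for g v
    using fun_cong[OF coeffs[OF that]] .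
  show thesis
  proof
    show "N \<in> nontriv_seminorms av"
      unfolding nontriv_seminorms_def
    proof (intro CollectI conjI ballI allI)
      show "N \<in> extensional linear_forms" by (simp add: N_def)
      show "N g \<ge> 0" if "g \<in> linear_forms" for g
        using that by (simp add: N_def mult_seminormsD(1)[OF x L])
      show "N (\<lambda>v. c * g v) = av c * N g" if g: "g \<in> linear_forms" for c g
      proof -
        have "N (\<lambda>v. c * g v) = x (L (\<lambda>i. c * coeffs g i))"
          using lin[OF g] by (intro N linear_forms_scale g) (simp add: sum_distrib_left mult.assoc)
        also have "\<dots> = av c * x (L (coeffs g))"
          unfolding L_scale by (simp add: mult_seminormsD(2,3)[OF x] L)
        finally show ?thesis by (simp add: N_def g)
      qed
      show "N (\<lambda>v. g v + h v) \<le> max (N g) (N h)" if g: "g \<in> linear_forms" and h: "h \<in> linear_forms" for g h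
      proof -
        have "N (\<lambda>v. g v + h v) = x (L (\<lambda>i. coeffs g i + coeffs h i))"
          using lin[OF g] lin[OF h]
          by (intro N linear_forms_add g h) (simp add: distrib_right sum.distrib)
        also have "\<dots> \<le> max (x (L (coeffs g))) (x (L (coeffs h)))"
          unfolding L_add by (rule mult_seminormsD(4)[OF x L L])
        finally show ?thesis by (simp add: N_def g h)
      qed
      obtain i where "i \<le> n" "x (mp_var i) \<noteq> 0"
        using mult_seminormsD(5)[OF x] by blast
      then show "\<exists>g\<in>linear_forms. N g \<noteq> 0"
        using N_f spanning_linear[OF f] by metis
    qed
    show "p = trop_coords n (\<lambda>i. N (f i))"
      unfolding q(2) q_eq trop_map_class[OF x]
      by (rule trop_coords_eqI[of _ _ 1, symmetric])
        (auto simp: projective_coords_mult_seminorm[OF x] N_f)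
  qed
qed

end

section \<open>Objects and morphisms of the category of linear immersions\<close>

text \<open>The locus where the projection to the coordinates in \<open>T\<close> is defined.\<close>

definition coord_open :: "nat \<Rightarrow> nat set \<Rightarrow> (nat, 'k::field) mpoly set set" where
  "coord_open n T = {P \<in> proj_points {..n}. \<exists>i\<in>T. mp_var i \<notin> P}"

lemma coord_open_full: "coord_open n {..n} = proj_points {..n}"
  by (auto simp: coord_open_def proj_points_def)

lemma zariski_open_coord_open:
  assumes "T \<subseteq> {..n}"
  shows "zariski_open {..n} (coord_open n T)"
  unfolding zariski_open_def
proof (intro exI conjI)
  show "mp_var ` T \<subseteq> mpolys {..n}"
    using assms by (auto intro: mpolys_var)
  show "coord_open n T = {P \<in> proj_points {..n}. \<not> mp_var ` T \<subseteq> P}"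
    by (auto simp: coord_open_def)
qed

lemma torus_invariant_coord_open: "T \<subseteq> {..n} \<Longrightarrow> torus_invariant {..n} (coord_open n T)"
  unfolding torus_invariant_def coord_open_def by blast

lemma combination_reindex:
  fixes f :: "'j \<Rightarrow> 'v \<Rightarrow> 'k::field"
  assumes "finite A" "finite B" "\<sigma> ` A \<subseteq> B"
  shows "(\<Sum>i\<in>A. a i * f (\<sigma> i) v) = (\<Sum>j\<in>B. (\<Sum>i\<in>{i \<in> A. \<sigma> i = j}. a i) * f j v)"
proof -
  have "(\<Sum>i\<in>A. a i * f (\<sigma> i) v) = (\<Sum>j\<in>B. \<Sum>i\<in>{i \<in> A. \<sigma> i = j}. a i * f (\<sigma> i) v)"
    using sum.group[OF assms, of "\<lambda>i. a i * f (\<sigma> i) v"] by simp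
  also have "\<dots> = (\<Sum>j\<in>B. (\<Sum>i\<in>{i \<in> A. \<sigma> i = j}. a i) * f j v)"
    by (simp add: sum_distrib_right)
  finally show ?thesis .
qed

definition coordinate_forms :: "('k::field ^ 'n \<Rightarrow> 'k) set" where
  "coordinate_forms = range (\<lambda>i v. v $ i)"

lemma finite_coordinate_forms: "finite (coordinate_forms :: ('k::field ^ 'n::finite \<Rightarrow> 'k) set)"
  by (simp add: coordinate_forms_def)

lemma coordinate_forms_linear: "coordinate_forms \<subseteq> linear_forms"
  by (auto simp: coordinate_forms_def linear_forms_coordinate)

lemma spanning_forms_if_coordinates:
  fixes f :: "nat \<Rightarrow> 'k::field ^ 'n::finite \<Rightarrow> 'k"
  assumes f: "f \<in> {..n} \<rightarrow>\<^sub>E linear_forms" and coord: "coordinate_forms \<subseteq> f ` {..n}"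
  shows "spanning_forms n f"
  unfolding spanning_forms_def
proof (intro conjI f ballI)
  fix g :: "'k ^ 'n \<Rightarrow> 'k" assume g: "g \<in> linear_forms"
  have "\<forall>i. \<exists>j\<le>n. (\<lambda>v. v $ i) = f j"
    using coord by (auto simp: coordinate_forms_def)
  then obtain k where k: "\<And>i. k i \<le> n" "\<And>i. (\<lambda>v. v $ i) = f (k i)" by metis
  have "g v = (\<Sum>i\<in>UNIV. g (axis i 1) * f (k i) v)" for v
    by (subst linear_forms_expand[OF g]) (simp flip: k(2))
  also have "(\<Sum>i\<in>UNIV. g (axis i 1) * f (k i) v)
      = (\<Sum>j\<le>n. (\<Sum>i\<in>{i \<in> UNIV. k i = j}. g (axis i 1)) * f j v)" for v
    by (rule combination_reindex) (use k(1) in auto)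
  finally show "\<exists>a. g = (\<lambda>v. \<Sum>j\<le>n. a j * f j v)"
    by (intro exI ext)
qed

lemma tuple_of_finite_set:
  fixes S :: "('k::field ^ 'n::finite \<Rightarrow> 'k) set"
  assumes "finite S" "S \<subseteq> linear_forms" "coordinate_forms \<subseteq> S"
  obtains n f where "spanning_forms n f" "f ` {..n} = S"
proof -
  obtain h where h: "bij_betw h {0..<card S} S"
    using ex_bij_betw_nat_finite[OF assms(1)] by blast
  have "S \<noteq> {}"
    using assms(3) by (auto simp: coordinate_forms_def)
  then obtain m where "card S = Suc m"
    using assms(1) by (metis card_gt_0_iff gr0_conv_Suc)
  then have "{0..<card S} = {..card S - 1}"
    by (simp add: atLeast0LessThan lessThan_Suc_atMost)
  then have im: "restrict h {..card S - 1} ` {..card S - 1} = S"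
    using h by (simp add: bij_betw_def)
  then have "restrict h {..card S - 1} \<in> {..card S - 1} \<rightarrow>\<^sub>E linear_forms"
    using assms(2) by (auto intro!: restrict_PiE_iff[THEN iffD2])
  with im assms(3) show ?thesis
    by (intro that[of "card S - 1" "restrict h {..card S - 1}"] spanning_forms_if_coordinates) auto
qed

text \<open>The image of projective space avoids the center of the projection to the coordinates in \<open>T\<close>
  precisely when these coordinates have no common zero on it. If they span, a point at which all of
  them vanish is a point at which all coordinate forms vanish, and there is none.\<close>

lemma immersion_coord_open:
  fixes f :: "nat \<Rightarrow> 'k::field ^ 'n::finite \<Rightarrow> 'k"
  assumes f: "spanning_forms n f" and T: "T \<subseteq> {..n}"
    and span: "\<And>g. g \<in> linear_forms \<Longrightarrow> \<exists>a. g = (\<lambda>v. \<Sum>i\<in>T. a i * f i v)"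
  shows "(n, linear_map_class n f, coord_open n T) \<in> immersions"
proof -
  have "proj_map {..n} (\<lambda>i. form_poly (f i)) P \<in> coord_open n T"
    if P: "P \<in> proj_points (UNIV :: 'n set)" for P :: "('n, 'k) mpoly set"
  proof -
    have "\<exists>i\<in>T. form_poly (f i) \<notin> P"
    proof (rule ccontr)
      assume "\<not> ?thesis"
      then have T_P: "form_poly (f i) \<in> P" if "i \<in> T" for i using that by blast
      have zero: "0 \<in> P" and add: "\<And>g h. g \<in> P \<Longrightarrow> h \<in> P \<Longrightarrow> g + h \<in> P"
        and mult: "\<And>g h. h \<in> P \<Longrightarrow> g * h \<in> P"
        using P by (auto simp: proj_points_def homogeneous_prime_def)
      have sum_P: "sum g A \<in> P" if "\<And>i. i \<in> A \<Longrightarrow> g i \<in> P" for g :: "nat \<Rightarrow> _" and A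
        using that by (induction A rule: infinite_finite_induct) (auto simp: zero add)
      have "mp_var j \<in> P" for j
      proof -
        obtain a where a: "(\<lambda>v. v $ j) = (\<lambda>v. \<Sum>i\<in>T. a i * f i v)"
          using span[OF linear_forms_coordinate] by blast
        have "mp_var j = (\<Sum>i\<in>T. mp_const (a i) * form_poly (f i))"
          unfolding form_poly_coordinate[symmetric] a form_poly_combination ..
        then show ?thesis by (simp add: sum_P mult T_P)
      qed
      with P show False by (auto simp: proj_points_def)
    qed
    then obtain i where i: "i \<in> T" "form_poly (f i) \<notin> P" by blast
    have "proj_map {..n} (\<lambda>i. form_poly (f i)) P \<in> proj_points {..n}"
      using i T by (intro proj_map_in_proj_points[OF P homogeneous_form_poly, of _ _ i]) auto
    moreover have "mp_var i \<notin> proj_map {..n} (\<lambda>i. form_poly (f i)) P"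
      using i by (simp add: proj_map_def)
    ultimately show ?thesis
      using i by (auto simp: coord_open_def)
  qed
  then show ?thesis
    unfolding immersions_def
    by (intro CollectI exI[of _ n] exI[of _ f] exI[of _ "coord_open n T"] conjI refl f ballI
        zariski_open_coord_open[OF T] torus_invariant_coord_open[OF T])
qed

lemma immersion_full:
  fixes f :: "nat \<Rightarrow> 'k::field ^ 'n::finite \<Rightarrow> 'k"
  assumes "spanning_forms n f"
  shows "(n, linear_map_class n f, proj_points {..n}) \<in> immersions"
  using immersion_coord_open[OF assms, of "{..n}"] assms
  by (simp add: coord_open_full spanning_forms_def)

lemma coordinate_morphism:
  fixes f :: "nat \<Rightarrow> 'k::field ^ 'n::finite \<Rightarrow> 'k"
  assumes \<sigma>: "\<sigma> \<in> {..n'} \<rightarrow>\<^sub>E {..n}" and U: "U \<subseteq> coord_open n (\<sigma> ` {..n'})"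
  shows "immersion_morphism (n, linear_map_class n f, U)
    (n', linear_map_class n' (\<lambda>j\<in>{..n'}. f (\<sigma> j)), proj_points {..n'}) \<sigma>"
proof -
  have \<sigma>': "\<sigma> j \<le> n" if "j \<le> n'" for j
    using \<sigma> that by auto
  have "proj_map {..n'} (\<lambda>j. mp_var (\<sigma> j)) P \<in> proj_points {..n'}" if P: "P \<in> U" for P
  proof -
    obtain j where "P \<in> proj_points {..n}" "j \<le> n'" "mp_var (\<sigma> j) \<notin> P"
      using U P by (auto simp: coord_open_def)
    then show ?thesis
      by (intro proj_map_in_proj_points[of P "{..n}" _ _ j] homogeneous_var mpolys_var) (auto simp: \<sigma>')
  qed
  moreover have "(\<lambda>f. \<lambda>j\<in>{..n'}. f (\<sigma> j)) ` linear_map_class n f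
      = linear_map_class n' (\<lambda>j\<in>{..n'}. f (\<sigma> j))"
  proof -
    have "(\<lambda>j\<in>{..n'}. (\<lambda>i\<in>{..n}. \<lambda>v. c * f i v) (\<sigma> j))
        = (\<lambda>i\<in>{..n'}. \<lambda>v. c * (\<lambda>j\<in>{..n'}. f (\<sigma> j)) i v)" for c
      using \<sigma>' by auto
    then show ?thesis
      unfolding linear_map_class_def setcompr_eq_image image_image by simp
  qed
  ultimately show ?thesis
    using \<sigma> by simp
qed

section \<open>Points of the limit are seminorms up to homothety\<close>

context complete_nonarch_field begin

text \<open>The seminorm \<open>N\<close> yields the component of \<open>y\<close> at every immersion all of whose forms lie in \<open>S\<close>. For
  finite \<open>S\<close> that contain the coordinate forms such an \<open>N\<close> can be read off from a single component; the
  goal is the set of all linear forms.\<close>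

definition realizes ::
    "(('k, 'n::finite) immersion \<Rightarrow> (nat \<Rightarrow> ereal) set) \<Rightarrow> ('k ^ 'n \<Rightarrow> 'k) set \<Rightarrow>
     (('k ^ 'n \<Rightarrow> 'k) \<Rightarrow> real) \<Rightarrow> bool" where
  "realizes y S N \<longleftrightarrow> N \<in> nontriv_seminorms av \<and>
     (\<forall>n f U. spanning_forms n f \<longrightarrow> f ` {..n} \<subseteq> S \<longrightarrow> (n, linear_map_class n f, U) \<in> immersions \<longrightarrow>
        y (n, linear_map_class n f, U) = trop_coords n (\<lambda>i. N (f i)))"

lemma limit_value:
  fixes f :: "nat \<Rightarrow> 'k ^ 'n::finite \<Rightarrow> 'k"
  assumes y: "y \<in> topspace (trop_limit av)" and f: "spanning_forms n f"
    and i: "(n, linear_map_class n f, U) \<in> immersions"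
  obtains N where "N \<in> nontriv_seminorms av"
    "y (n, linear_map_class n f, U) = trop_coords n (\<lambda>i. N (f i))"
proof -
  have "y (n, linear_map_class n f, U) \<in> topspace (Trop av (n, linear_map_class n f, U))"
    using y i by (auto simp: trop_limit_def simp del: Trop.simps)
  then show ?thesis
    using seminorm_of_trop[OF f] that by auto
qed

lemma limit_transition:
  assumes "y \<in> topspace (trop_limit av)" "i \<in> immersions" "j \<in> immersions" "immersion_morphism i j \<sigma>"
  shows "trop_transition j \<sigma> (y i) = y j"
  using assms by (auto simp: trop_limit_def)

lemma limit_value_pullback:
  fixes f :: "nat \<Rightarrow> 'k ^ 'n::finite \<Rightarrow> 'k"
  assumes y: "y \<in> topspace (trop_limit av)" and f: "spanning_forms n f"
    and i: "(n, linear_map_class n f, U) \<in> immersions"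
    and \<sigma>: "\<sigma> \<in> {..n'} \<rightarrow>\<^sub>E {..n}" and U: "U \<subseteq> coord_open n (\<sigma> ` {..n'})"
    and f': "spanning_forms n' f'" "\<And>j. j \<le> n' \<Longrightarrow> f' j = f (\<sigma> j)"
    and N: "N \<in> nontriv_seminorms av" "y (n, linear_map_class n f, U) = trop_coords n (\<lambda>i. N (f i))"
  shows "y (n', linear_map_class n' f', proj_points {..n'}) = trop_coords n' (\<lambda>j. N (f' j))"
proof -
  have f'_eq: "f' = (\<lambda>j\<in>{..n'}. f (\<sigma> j))"
    using f' by (auto simp: spanning_forms_def PiE_def extensional_def)
  have coords: "projective_coords n' (\<lambda>j. N (f (\<sigma> j)))"
    using projective_coords_seminorm[OF N(1) f'(1)] f'(2) by (auto simp: projective_coords_def)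
  have "y (n', linear_map_class n' f', proj_points {..n'})
      = trop_transition (n', linear_map_class n' f', proj_points {..n'}) \<sigma> (trop_coords n (\<lambda>i. N (f i)))"
    using limit_transition[OF y i immersion_full[OF f'(1)]] coordinate_morphism[OF \<sigma> U, of f]
    by (simp add: N(2) f'_eq)
  also have "\<dots> = trop_coords n' (\<lambda>j. N (f (\<sigma> j)))"
    using \<sigma> by (intro trop_transition_coords projective_coords_seminorm[OF N(1) f] coords) auto
  also have "\<dots> = trop_coords n' (\<lambda>j. N (f' j))"
    by (rule trop_coords_eqI[OF coords, of 1, symmetric]) (auto simp: f'(2))
  finally show ?thesis .
qed

lemma immersion_open:
  "(n, \<iota>, U) \<in> immersions \<Longrightarrow> U \<subseteq> coord_open n {..n}"
  by (auto simp: immersions_def zariski_open_def coord_open_full)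

text \<open>The identity of coordinates is a morphism from the immersion into \<open>U\<close> to the one into the whole
  projective space, and it acts trivially on tropical points.\<close>

lemma limit_value_shrink:
  fixes f :: "nat \<Rightarrow> 'k ^ 'n::finite \<Rightarrow> 'k"
  assumes y: "y \<in> topspace (trop_limit av)" and f: "spanning_forms n f"
    and i: "(n, linear_map_class n f, U) \<in> immersions"
  shows "y (n, linear_map_class n f, U) = y (n, linear_map_class n f, proj_points {..n})"
proof -
  obtain N where N: "N \<in> nontriv_seminorms av"
    "y (n, linear_map_class n f, U) = trop_coords n (\<lambda>i. N (f i))"
    by (rule limit_value[OF assms])
  have "y (n, linear_map_class n f, proj_points {..n}) = trop_coords n (\<lambda>i. N (f i))"
    using immersion_open[OF i] N
    by (intro limit_value_pullback[OF y f i, of "\<lambda>j\<in>{..n}. j"] f) auto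
  with N show ?thesis by simp
qed

text \<open>Arrange \<open>S\<close> as one tuple \<open>f\<close> and take a seminorm \<open>N\<close> for its component. Every spanning tuple from \<open>S\<close>
  is obtained from \<open>f\<close> by a selection \<open>\<sigma>\<close> of coordinates. The selection is defined on a smaller toric
  open set, which still contains the image, and there it is a morphism; therefore \<open>N\<close> also gives the
  component of the selected tuple.\<close>

lemma realizes_finite:
  fixes S :: "('k ^ 'n::finite \<Rightarrow> 'k) set"
  assumes y: "y \<in> topspace (trop_limit av)"
    and S: "finite S" "S \<subseteq> linear_forms" "coordinate_forms \<subseteq> S"
  shows "\<exists>N. realizes y S N"
proof -
  obtain n f where f: "spanning_forms n f" and im: "f ` {..n} = S"
    using tuple_of_finite_set[OF S] by blast
  obtain N where N: "N \<in> nontriv_seminorms av"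
    and y_f: "y (n, linear_map_class n f, proj_points {..n}) = trop_coords n (\<lambda>i. N (f i))"
    by (rule limit_value[OF y f immersion_full[OF f]])
  have "y (n', linear_map_class n' f', U) = trop_coords n' (\<lambda>i. N (f' i))"
    if f': "spanning_forms n' f'" "f' ` {..n'} \<subseteq> S" and i: "(n', linear_map_class n' f', U) \<in> immersions"
    for n' f' U
  proof -
    have "\<forall>j\<in>{..n'}. \<exists>i. i \<le> n \<and> f' j = f i"
      using f'(2) im by auto
    from bchoice[OF this] obtain s where s: "\<And>j. j \<le> n' \<Longrightarrow> s j \<le> n \<and> f' j = f (s j)"
      by auto
    define \<sigma> where "\<sigma> = restrict s {..n'}"
    have \<sigma>: "\<sigma> \<in> {..n'} \<rightarrow>\<^sub>E {..n}" and f'_eq: "\<And>j. j \<le> n' \<Longrightarrow> f' j = f (\<sigma> j)"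
      using s by (auto simp: \<sigma>_def)
    have obj: "(n, linear_map_class n f, coord_open n (\<sigma> ` {..n'})) \<in> immersions"
    proof (rule immersion_coord_open[OF f])
      show "\<sigma> ` {..n'} \<subseteq> {..n}" using \<sigma> by auto
      fix g :: "'k ^ 'n \<Rightarrow> 'k" assume "g \<in> linear_forms"
      then obtain a where "g = (\<lambda>v. \<Sum>j\<le>n'. a j * f' j v)"
        using f'(1) by (auto simp: spanning_forms_def)
      then have "g v = (\<Sum>j\<le>n'. a j * f (\<sigma> j) v)" for v
        by (simp add: f'_eq)
      also have "(\<Sum>j\<le>n'. a j * f (\<sigma> j) v)
          = (\<Sum>i\<in>\<sigma> ` {..n'}. (\<Sum>j\<in>{j \<in> {..n'}. \<sigma> j = i}. a j) * f i v)" for v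
        by (rule combination_reindex) auto
      finally show "\<exists>a. g = (\<lambda>v. \<Sum>i\<in>\<sigma> ` {..n'}. a i * f i v)"
        by (intro exI ext)
    qed
    have "y (n', linear_map_class n' f', proj_points {..n'}) = trop_coords n' (\<lambda>i. N (f' i))"
      using y_f limit_value_shrink[OF y f obj]
      by (intro limit_value_pullback[OF y f obj \<sigma> order.refl f'(1) f'_eq N]) auto
    with limit_value_shrink[OF y f'(1) i] show ?thesis by simp
  qed
  with N show ?thesis by (auto simp: realizes_def)
qed

lemma realizes_mono: "realizes y S N \<Longrightarrow> S' \<subseteq> S \<Longrightarrow> realizes y S' N"
  unfolding realizes_def by blast

lemma realizes_proportional:
  fixes S :: "('k ^ 'n::finite \<Rightarrow> 'k) set"
  assumes S: "finite S" "S \<subseteq> linear_forms" "coordinate_forms \<subseteq> S"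
    and N: "realizes y S N" and N': "realizes y S N'"
  obtains c where "c > 0" "\<And>g. g \<in> S \<Longrightarrow> N' g = c * N g"
proof -
  obtain n f where f: "spanning_forms n f" and im: "f ` {..n} = S"
    using tuple_of_finite_set[OF S] by blast
  have "trop_coords n (\<lambda>i. N (f i)) = trop_coords n (\<lambda>i. N' (f i))"
    using N N' f im immersion_full[OF f] unfolding realizes_def by (metis order.refl)
  moreover have "projective_coords n (\<lambda>i. N (f i))" "projective_coords n (\<lambda>i. N' (f i))"
    using N N' f by (auto simp: realizes_def projective_coords_seminorm)
  ultimately obtain c where "c > 0" "\<forall>i\<le>n. N' (f i) = c * N (f i)"
    using trop_coords_eq_iff by meson
  with im that show ?thesis by blast
qed

lemma seminorm_nonzero_on_coordinates:
  fixes N :: "('k ^ 'n::finite \<Rightarrow> 'k) \<Rightarrow> real"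
  assumes "N \<in> nontriv_seminorms av"
  obtains e where "e \<in> coordinate_forms" "N e > 0"
proof -
  obtain n f where f: "spanning_forms n f" "f ` {..n} = (coordinate_forms :: ('k ^ 'n \<Rightarrow> 'k) set)"
    using tuple_of_finite_set[OF finite_coordinate_forms coordinate_forms_linear order.refl] by blast
  obtain i where "i \<le> n" "N (f i) \<noteq> 0"
    using seminorm_nonzero_on_generators[OF assms f(1)] by blast
  moreover have "N (f i) \<ge> 0"
    using nontriv_seminormsD(2)[OF assms] spanning_linear[OF f(1) \<open>i \<le> n\<close>] by blast
  ultimately show ?thesis
    using f(2) by (intro that[of "f i"]) auto
qed

text \<open>On the coordinate forms together with any one form \<open>g\<close> the two seminorms are proportional. The
  factor is the ratio of their values at a fixed coordinate form, hence the same for all \<open>g\<close>.\<close>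

lemma realizes_unique:
  fixes N N' :: "('k ^ 'n::finite \<Rightarrow> 'k) \<Rightarrow> real"
  assumes N: "realizes y linear_forms N" and N': "realizes y linear_forms N'"
  shows "(N, N') \<in> homothety av"
proof -
  let ?E = "coordinate_forms :: ('k ^ 'n \<Rightarrow> 'k) set"
  have nt: "N \<in> nontriv_seminorms av" "N' \<in> nontriv_seminorms av"
    using N N' by (auto simp: realizes_def)
  obtain e where e: "e \<in> ?E" "N e > 0"
    using seminorm_nonzero_on_coordinates[OF nt(1)] by blast
  have ratio: "\<exists>c>0. \<forall>h\<in>insert g ?E. N' h = c * N h" if g: "g \<in> linear_forms" for g
  proof -
    have "insert g ?E \<subseteq> linear_forms" using g coordinate_forms_linear by auto
    with realizes_proportional[of "insert g ?E" y N N'] N N' show ?thesis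
      by (metis finite_coordinate_forms finite_insert realizes_mono subset_insertI)
  qed
  have "N' g = (N' e / N e) * N g" if "g \<in> linear_forms" for g
    using ratio[OF that] e by auto
  moreover have "N' e / N e > 0"
    using ratio[OF linear_forms_zero] e by auto
  ultimately show ?thesis
    using nt unfolding homothety_def by blast
qed

text \<open>For each finite \<open>S\<close> choose a seminorm that realizes \<open>y\<close> on \<open>S\<close> and the coordinate forms, and
  normalize it at one coordinate form \<open>e\<close> where these seminorms do not vanish. Two normalized choices
  agree wherever both are determined by \<open>y\<close>, so they glue. Each seminorm axiom and each component of
  \<open>y\<close> involves finitely many forms, and for these the glued function is one of the chosen seminorms up
  to a factor.\<close>

lemma realizes_exists:
  fixes y :: "('k, 'n::finite) immersion \<Rightarrow> (nat \<Rightarrow> ereal) set"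
  assumes y: "y \<in> topspace (trop_limit av)"
  shows "\<exists>N. realizes y linear_forms N"
proof -
  let ?E = "coordinate_forms :: ('k ^ 'n \<Rightarrow> 'k) set"
  have "\<forall>S\<in>{S. finite S \<and> S \<subseteq> linear_forms}. \<exists>N. realizes y (S \<union> ?E) N"
    by (intro ballI realizes_finite[OF y]) (auto simp: finite_coordinate_forms coordinate_forms_linear[THEN subsetD])
  from bchoice[OF this] obtain M
    where M: "\<And>S. finite S \<Longrightarrow> S \<subseteq> linear_forms \<Longrightarrow> realizes y (S \<union> ?E) (M S)" by auto
  have M_nt: "M S \<in> nontriv_seminorms av" if "finite S" "S \<subseteq> linear_forms" for S
    using M[OF that] by (simp add: realizes_def)
  obtain e where e: "e \<in> ?E" "M {} e > 0"
    using seminorm_nonzero_on_coordinates[OF M_nt[of "{}"]] by auto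
  have compat: "\<exists>c>0. \<forall>g\<in>S \<union> ?E. M S' g = c * M S g"
    if S': "finite S'" "S' \<subseteq> linear_forms" and S: "S \<subseteq> S'" for S S'
  proof -
    have fS: "finite S" "S \<subseteq> linear_forms" using S S' finite_subset by auto
    then have "finite (S \<union> ?E)" "S \<union> ?E \<subseteq> linear_forms"
      using finite_coordinate_forms coordinate_forms_linear by auto
    moreover have "realizes y (S \<union> ?E) (M S')"
      using S by (intro realizes_mono[OF M[OF S']]) auto
    ultimately show ?thesis
      using realizes_proportional[of "S \<union> ?E" y "M S" "M S'"] M[OF fS] by (metis Un_upper2)
  qed
  have pos: "M S e > 0" if "finite S" "S \<subseteq> linear_forms" for S
    using compat[OF that, of "{}"] e by (auto)
  \<comment> \<open>The choice for \<open>S\<close>, normalized at \<open>e\<close>. By \<open>compat\<close> for the empty set, \<open>e\<close> works for all \<open>S\<close>.\<close>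
  define K where "K = (\<lambda>S g. M S g / M S e)"
  have K: "K S' g = K S g" if "finite S'" "S' \<subseteq> linear_forms" "S \<subseteq> S'" "g \<in> S" for S S' g
    using compat[OF that(1-3)] that(4) e(1) by (auto simp: K_def)
  define N where "N = restrict (\<lambda>g. K {g} g) linear_forms"
  have N: "N g = K S g" if "finite S" "S \<subseteq> linear_forms" "g \<in> S" for S g
  proof -
    have "g \<in> linear_forms" using that by auto
    then show ?thesis using K[OF that(1,2), of "{g}" g] that(3) by (simp add: N_def)
  qed
  have N_nt: "N \<in> nontriv_seminorms av"
    unfolding nontriv_seminorms_def
  proof (intro CollectI conjI ballI allI)
    show "N \<in> extensional linear_forms" by (simp add: N_def)
  next
    fix g :: "'k ^ 'n \<Rightarrow> 'k" assume g: "g \<in> linear_forms"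
    then have S: "finite {g}" "{g} \<subseteq> linear_forms" by auto
    show "N g \<ge> 0"
      using nontriv_seminormsD(2)[OF M_nt[OF S] g] pos[OF S]
      by (simp add: N[OF S] K_def)
  next
    fix c :: 'k and g :: "'k ^ 'n \<Rightarrow> 'k" assume g: "g \<in> linear_forms"
    let ?S = "{g, \<lambda>v. c * g v}"
    have S: "finite ?S" "?S \<subseteq> linear_forms" using g by (auto intro: linear_forms_scale)
    show "N (\<lambda>v. c * g v) = av c * N g"
      using nontriv_seminormsD(3)[OF M_nt[OF S] g, of c]
      by (simp add: N[OF S] K_def)
  next
    fix g h :: "'k ^ 'n \<Rightarrow> 'k" assume g: "g \<in> linear_forms" and h: "h \<in> linear_forms"
    let ?S = "{g, h, \<lambda>v. g v + h v}"
    have S: "finite ?S" "?S \<subseteq> linear_forms" using g h by (auto intro: linear_forms_add)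
    show "N (\<lambda>v. g v + h v) \<le> max (N g) (N h)"
      using nontriv_seminormsD(4)[OF M_nt[OF S] g h] pos[OF S]
      by (simp add: N[OF S] K_def max_def divide_le_cancel split: if_splits)
  next
    have S: "finite {e}" "{e} \<subseteq> linear_forms" using e coordinate_forms_linear by auto
    have "N e = 1" using pos[OF S] by (simp add: N[OF S] K_def)
    then show "\<exists>g\<in>linear_forms. N g \<noteq> 0" using S by (intro bexI[of _ e]) auto
  qed
  have "y (n, linear_map_class n f, U) = trop_coords n (\<lambda>i. N (f i))"
    if f: "spanning_forms n f" and i: "(n, linear_map_class n f, U) \<in> immersions" for n f U
  proof -
    let ?S = "f ` {..n}"
    have S: "finite ?S" "?S \<subseteq> linear_forms" using spanning_linear[OF f] by auto
    have "y (n, linear_map_class n f, U) = trop_coords n (\<lambda>i. M ?S (f i))"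
      using M[OF S] f i by (auto simp: realizes_def)
    also have "\<dots> = trop_coords n (\<lambda>i. N (f i))"
      using pos[OF S]
      by (intro trop_coords_eqI[of _ _ "1 / M ?S e", symmetric]
          projective_coords_seminorm[OF M_nt[OF S] f]) (auto simp: N[OF S] K_def)
    finally show ?thesis .
  qed
  with N_nt show ?thesis by (auto simp: realizes_def)
qed

end

section \<open>Open sets and continuous functions on tropical projective space\<close>

text \<open>The inverse of \<^const>\<open>neg_log\<close>; it makes tropical coordinates real numbers, of which ratios can be
  taken.\<close>

definition exp_neg :: "ereal \<Rightarrow> real" where
  "exp_neg a = (if a = \<infinity> then 0 else exp (- real_of_ereal a))"

lemma exp_neg_nonneg [simp]: "exp_neg a \<ge> 0"
  by (simp add: exp_neg_def)

lemma exp_neg_eq_0_iff [simp]: "exp_neg a = 0 \<longleftrightarrow> a = \<infinity>"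
  by (simp add: exp_neg_def)

lemma neg_log_exp_neg: "a \<noteq> -\<infinity> \<Longrightarrow> neg_log (exp_neg a) = a"
  by (cases a) (auto simp: neg_log_def exp_neg_def)

lemma continuous_on_neg_log: "continuous_on {0..} neg_log"
  unfolding continuous_on_def
proof
  fix x :: real assume x: "x \<in> {0..}"
  show "(neg_log \<longlongrightarrow> neg_log x) (at x within {0..})"
  proof (cases "x = 0")
    case True
    have "\<forall>\<^sub>F y in at 0 within {0..}. ereal r < neg_log y" for r
      unfolding eventually_at
    proof (intro exI[of _ "exp (- r)"] conjI ballI impI)
      fix y :: real assume y: "y \<in> {0..}" "y \<noteq> 0 \<and> dist y 0 < exp (- r)"
      then have "ln y < ln (exp (- r))"
        by (subst ln_less_cancel_iff) auto
      with y show "ereal r < neg_log y"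
        by (simp add: neg_log_def)
    qed simp
    then show ?thesis
      using True by (simp add: tendsto_PInfty neg_log_def)
  next
    case False
    with x have pos: "x > 0" by simp
    have "((\<lambda>y. ereal (- ln y)) \<longlongrightarrow> ereal (- ln x)) (at x within {0..})"
      using pos by (intro tendsto_intros) auto
    moreover have "\<forall>\<^sub>F y in at x within {0..}. ereal (- ln y) = neg_log y"
      unfolding eventually_at using pos
      by (intro exI[of _ x]) (auto simp: neg_log_def dist_real_def)
    ultimately have "(neg_log \<longlongrightarrow> ereal (- ln x)) (at x within {0..})"
      by (rule Lim_transform_eventually)
    then show ?thesis
      using False by (simp add: neg_log_def[of x])
  qed
qed

lemma continuous_on_exp_neg: "continuous_on (- {-\<infinity>}) exp_neg"
  unfolding continuous_on_def
proof
  fix a :: ereal assume a: "a \<in> - {-\<infinity>}"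
  show "(exp_neg \<longlongrightarrow> exp_neg a) (at a within - {-\<infinity>})"
  proof (cases "a = \<infinity>")
    case True
    have "\<forall>\<^sub>F b in at \<infinity> within - {-\<infinity>}. exp_neg b < e" if "e > 0" for e :: real
      unfolding eventually_at_topological
    proof (intro exI[of _ "{ereal (- ln e)<..}"] conjI ballI impI)
      fix b assume b: "b \<in> {ereal (- ln e)<..}"
      show "exp_neg b < e"
      proof (cases b)
        case (real r)
        with b have "exp (- r) < exp (ln e)" by simp
        with real that show ?thesis by (simp add: exp_neg_def)
      qed (use b that in \<open>auto simp: exp_neg_def\<close>)
    qed auto
    then have "(exp_neg \<longlongrightarrow> 0) (at \<infinity> within - {-\<infinity>})"
      by (intro order_tendstoI) (auto intro: always_eventually less_le_trans[OF _ exp_neg_nonneg])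
    with True show ?thesis by (simp add: exp_neg_def[of \<infinity>])
  next
    case False
    with a have fin: "\<bar>a\<bar> \<noteq> \<infinity>" by (cases a) auto
    have "(real_of_ereal \<longlongrightarrow> real_of_ereal a) (at a within - {-\<infinity>})"
      using continuous_at_imp_continuous_within[OF continuous_at_of_ereal[OF fin]]
      by (simp add: continuous_within)
    then have "((\<lambda>b. exp (- real_of_ereal b)) \<longlongrightarrow> exp (- real_of_ereal a)) (at a within - {-\<infinity>})"
      by (intro tendsto_exp tendsto_minus)
    moreover have "\<forall>\<^sub>F b in at a within - {-\<infinity>}. exp (- real_of_ereal b) = exp_neg b"
      unfolding eventually_at_topological using False
      by (intro exI[of _ "- {\<infinity>}"]) (auto simp: exp_neg_def open_Compl)
    ultimately have "(exp_neg \<longlongrightarrow> exp (- real_of_ereal a)) (at a within - {-\<infinity>})"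
      by (rule Lim_transform_eventually)
    then show ?thesis
      using False by (simp add: exp_neg_def[of a])
  qed
qed

lemma topspace_trop_vectors:
  "topspace (subtopology (product_topology (\<lambda>_. euclidean) {..n}) (trop_vectors n)) = trop_vectors n"
  by (auto simp: trop_vectors_def)

lemma topspace_trop_proj_space: "topspace (trop_proj_space n) = trop_point n ` trop_vectors n"
  unfolding trop_proj_space_def topspace_quot_topology topspace_trop_vectors ..

lemma trop_point_restrict: "trop_point n (restrict u {..n}) = trop_point n u"
  by (simp add: trop_point_def cong: restrict_cong)

lemma trop_point_exp_neg:
  assumes "u \<in> trop_vectors n"
  shows "projective_coords n (\<lambda>i. exp_neg (u i))" "trop_point n u = trop_coords n (\<lambda>i. exp_neg (u i))"
proof -
  show "projective_coords n (\<lambda>i. exp_neg (u i))"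
    using assms by (auto simp: projective_coords_def trop_vectors_def)
  have "neg_log (exp_neg (u i)) = u i" if "i \<le> n" for i
    using assms that by (intro neg_log_exp_neg) (auto simp: trop_vectors_def)
  then have "(\<lambda>i\<in>{..n}. neg_log (exp_neg (u i))) = restrict u {..n}"
    by auto
  then show "trop_point n u = trop_coords n (\<lambda>i. exp_neg (u i))"
    by (simp add: trop_coords_def trop_point_def)
qed

text \<open>The tropical points at which coordinate \<open>i\<close> is finite and the ratio of the exponentials of
  coordinates \<open>j\<close> and \<open>i\<close> lies in \<open>V\<close>. These ratios are the affine coordinates on the chart of points
  with finite \<open>i\<close>-th coordinate.\<close>

definition ratio_set :: "nat \<Rightarrow> nat \<Rightarrow> nat \<Rightarrow> real set \<Rightarrow> (nat \<Rightarrow> ereal) set set" where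
  "ratio_set n i j V = {trop_coords n a |a. projective_coords n a \<and> a i \<noteq> 0 \<and> a j / a i \<in> V}"

lemma trop_coords_in_ratio_set:
  assumes "projective_coords n a" "i \<le> n" "j \<le> n"
  shows "trop_coords n a \<in> ratio_set n i j V \<longleftrightarrow> a i \<noteq> 0 \<and> a j / a i \<in> V"
proof
  assume "trop_coords n a \<in> ratio_set n i j V"
  then obtain b where b: "projective_coords n b" "trop_coords n a = trop_coords n b" "b i \<noteq> 0" "b j / b i \<in> V"
    by (auto simp: ratio_set_def)
  then obtain c where "c > 0" "\<forall>i\<le>n. b i = c * a i"
    using trop_coords_eq_iff assms(1) by meson
  with b assms show "a i \<noteq> 0 \<and> a j / a i \<in> V" by auto
qed (use assms in \<open>auto simp: ratio_set_def\<close>)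

text \<open>Openness in the quotient means openness of the set of all representing vectors, where the ratio
  is a continuous function on an open subset.\<close>

lemma openin_ratio_set:
  assumes ij: "i \<le> n" "j \<le> n" and V: "open V"
  shows "openin (trop_proj_space n) (ratio_set n i j V)"
proof -
  let ?X = "subtopology (product_topology (\<lambda>_. euclidean) {..n}) (trop_vectors n)"
  have coord: "continuous_map ?X euclideanreal (\<lambda>u. exp_neg (u k))" if "k \<le> n" for k
  proof -
    have "continuous_map ?X (top_of_set (- {-\<infinity>})) (\<lambda>u. u k)"
      using that by (auto simp: continuous_map_in_subtopology trop_vectors_def
          intro!: continuous_map_from_subtopology continuous_map_product_projection)
    from continuous_map_compose[OF this, of euclideanreal exp_neg] continuous_on_exp_neg
    show ?thesis by (simp add: o_def)
  qed
  let ?D = "{u \<in> topspace ?X. exp_neg (u i) \<in> - {0}}"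
  have D: "openin ?X ?D"
    by (rule openin_continuous_map_preimage[OF coord]) (auto simp: ij open_Compl)
  have "continuous_map (subtopology ?X ?D) euclideanreal (\<lambda>u. exp_neg (u j) / exp_neg (u i))"
    by (intro continuous_map_real_divide continuous_map_from_subtopology coord ij) auto
  from openin_continuous_map_preimage[OF this, of V] V
  have "openin (subtopology ?X ?D)
      {u \<in> topspace (subtopology ?X ?D). exp_neg (u j) / exp_neg (u i) \<in> V}" by simp
  then have "openin ?X {u \<in> topspace (subtopology ?X ?D). exp_neg (u j) / exp_neg (u i) \<in> V}"
    by (rule openin_trans_full[OF _ D])
  also have "{u \<in> topspace (subtopology ?X ?D). exp_neg (u j) / exp_neg (u i) \<in> V}
      = {u \<in> topspace ?X. exp_neg (u i) \<noteq> 0 \<and> exp_neg (u j) / exp_neg (u i) \<in> V}"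
    by auto
  also have "\<dots> = {u \<in> topspace ?X. trop_point n u \<in> ratio_set n i j V}"
    unfolding topspace_trop_vectors
    by (intro Collect_cong conj_cong refl)
      (simp add: trop_point_exp_neg trop_coords_in_ratio_set ij del: exp_neg_eq_0_iff)
  finally have "openin ?X {u \<in> topspace ?X. trop_point n u \<in> ratio_set n i j V}" .
  moreover have "ratio_set n i j V \<subseteq> trop_point n ` topspace ?X"
  proof
    fix p assume "p \<in> ratio_set n i j V"
    then obtain a where a: "projective_coords n a" "p = trop_coords n a"
      by (auto simp: ratio_set_def)
    have "p = trop_point n (\<lambda>i\<in>{..n}. neg_log (a i))"
      by (simp add: a(2) trop_coords_def trop_point_restrict)
    with neg_log_trop_vectors[OF a(1)] show "p \<in> trop_point n ` topspace ?X"
      unfolding topspace_trop_vectors by blast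
  qed
  ultimately show ?thesis
    by (simp add: trop_proj_space_def openin_quot_topology)
qed

section \<open>The map to the limit and its topological properties\<close>

lemma topspace_seminorm_topology: "topspace (seminorm_topology av) = nontriv_seminorms av"
proof -
  have "{N \<in> nontriv_seminorms av. N (\<lambda>v. 0) \<in> UNIV}
      \<in> {{N \<in> nontriv_seminorms av. N f \<in> V} |f V. f \<in> linear_forms \<and> open V}"
    using linear_forms_zero open_UNIV by blast
  then have "nontriv_seminorms av
      \<subseteq> \<Union> {{N \<in> nontriv_seminorms av. N f \<in> V} |f V. f \<in> linear_forms \<and> open V}"
    by blast
  then show ?thesis
    unfolding seminorm_topology_def topology_generated_by_topspace by blast
qed

lemma continuous_map_evaluation:
  assumes "g \<in> linear_forms"
  shows "continuous_map (seminorm_topology av) euclideanreal (\<lambda>N. N g)"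
  unfolding continuous_map_def
proof (intro conjI allI impI)
  fix V :: "real set" assume "openin euclideanreal V"
  then show "openin (seminorm_topology av) {N \<in> topspace (seminorm_topology av). N g \<in> V}"
    unfolding topspace_seminorm_topology
    unfolding seminorm_topology_def using assms
    by (intro topology_generated_by_Basis) auto
qed simp

context complete_nonarch_field begin

lemma homothety_equiv: "equiv (nontriv_seminorms av) (homothety av)"
proof (rule equivI)
  show "homothety av \<subseteq> nontriv_seminorms av \<times> nontriv_seminorms av"
    by (auto simp: homothety_def)
  show "refl_on (nontriv_seminorms av) (homothety av)"
    by (auto simp: refl_on_def homothety_def intro!: exI[of _ "1::real"])
  show "sym (homothety av)"
  proof (rule symI)
    fix N N' assume "(N, N') \<in> homothety av"
    then obtain c where "c > 0" "\<forall>g\<in>linear_forms. N' g = c * N g"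
      and nt: "N \<in> nontriv_seminorms av" "N' \<in> nontriv_seminorms av"
      unfolding homothety_def by blast
    then have "1 / c > 0 \<and> (\<forall>g\<in>linear_forms. N g = 1 / c * N' g)" by simp
    with nt show "(N', N) \<in> homothety av"
      unfolding homothety_def by blast
  qed
  show "trans (homothety av)"
  proof (rule transI)
    fix N N' N'' assume "(N, N') \<in> homothety av" "(N', N'') \<in> homothety av"
    then obtain c c' where "c > 0" "c' > 0" "\<forall>g\<in>linear_forms. N' g = c * N g"
      "\<forall>g\<in>linear_forms. N'' g = c' * N' g"
      and nt: "N \<in> nontriv_seminorms av" "N'' \<in> nontriv_seminorms av"
      unfolding homothety_def by blast
    then have "c' * c > 0 \<and> (\<forall>g\<in>linear_forms. N'' g = c' * c * N g)" by simp
    with nt show "(N, N'') \<in> homothety av"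
      unfolding homothety_def by blast
  qed
qed

lemma seminorm_trop_class:
  fixes N :: "('k ^ 'n::finite \<Rightarrow> 'k) \<Rightarrow> real"
  assumes N: "N \<in> nontriv_seminorms av" and f: "spanning_forms n f"
  shows "seminorm_trop (n, linear_map_class n f, U) (homothety av `` {N}) = trop_coords n (\<lambda>i. N (f i))"
proof -
  have *: "trop_point n (\<lambda>i. neg_log (N' (f' i))) = trop_coords n (\<lambda>i. N (f i))"
    if f': "f' \<in> linear_map_class n f" and N': "N' \<in> homothety av `` {N}" for f' N'
  proof -
    obtain c where c: "c \<noteq> 0" "f' = (\<lambda>i\<in>{..n}. \<lambda>v. c * f i v)"
      using f' unfolding linear_map_class_def by blast
    obtain d where d: "d > 0" "\<forall>g\<in>linear_forms. N' g = d * N g"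
      using N' by (auto simp: homothety_def)
    have "N' (f' i) = (d * av c) * N (f i)" if "i \<le> n" for i
      using spanning_linear[OF f that] that
      by (simp add: c(2) d linear_forms_scale nontriv_seminormsD(3)[OF N])
    then have "trop_coords n (\<lambda>i. N' (f' i)) = trop_coords n (\<lambda>i. N (f i))"
      using d(1) av_pos[OF c(1)]
      by (intro trop_coords_eqI[of _ _ "d * av c"] projective_coords_seminorm[OF N f]) auto
    then show ?thesis by (simp add: trop_coords_def)
  qed
  have "seminorm_trop (n, linear_map_class n f, U) (homothety av `` {N})
      = (\<Union>f'\<in>linear_map_class n f. \<Union>N'\<in>homothety av `` {N}. trop_coords n (\<lambda>i. N (f i)))"
    unfolding seminorm_trop.simps by (intro SUP_cong refl *)
  moreover have "N \<in> homothety av `` {N}"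
    by (rule equiv_class_self[OF homothety_equiv N])
  ultimately show ?thesis
    using linear_map_class_self[OF f] by auto
qed

abbreviation trop_family ::
    "(('k ^ 'n::finite \<Rightarrow> 'k) \<Rightarrow> real) set \<Rightarrow> ('k, 'n) immersion \<Rightarrow> (nat \<Rightarrow> ereal) set" where
  "trop_family x \<equiv> (\<lambda>i\<in>immersions. seminorm_trop i x)"

lemma immersionsE:
  assumes "i \<in> (immersions :: ('k, 'n::finite) immersion set)"
  obtains n f U where "i = (n, linear_map_class n f, U)" "spanning_forms n f"
  using assms unfolding immersions_def by blast

lemma realizes_trop_family:
  assumes "N \<in> nontriv_seminorms av"
  shows "realizes (trop_family (homothety av `` {N})) linear_forms N"
  using assms by (auto simp: realizes_def seminorm_trop_class simp del: seminorm_trop.simps)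

lemma eq_trop_family:
  fixes y :: "('k, 'n::finite) immersion \<Rightarrow> (nat \<Rightarrow> ereal) set"
  assumes y: "y \<in> topspace (trop_limit av)" and N: "realizes y linear_forms N"
  shows "y = trop_family (homothety av `` {N})"
proof
  fix i :: "('k, 'n) immersion"
  have nt: "N \<in> nontriv_seminorms av" using N by (simp add: realizes_def)
  show "y i = trop_family (homothety av `` {N}) i"
  proof (cases "i \<in> immersions")
    case True
    then obtain n f U where i: "i = (n, linear_map_class n f, U)" and f: "spanning_forms n f"
      by (rule immersionsE)
    have "f ` {..n} \<subseteq> linear_forms"
      using spanning_linear[OF f] by auto
    then have "y i = trop_coords n (\<lambda>i. N (f i))"
      using N f True unfolding realizes_def i by blast
    with True show ?thesis
      by (simp add: i seminorm_trop_class[OF nt f] del: seminorm_trop.simps)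
  next
    case False
    have "y \<in> extensional immersions"
      using y by (simp add: trop_limit_def PiE_def del: Trop.simps)
    from extensional_arb[OF this False] False show ?thesis
      by simp
  qed
qed

text \<open>Compatibility with a morphism: the forms of the target tuple are selected from those of the
  source only up to a common scalar \<open>c\<close>, since immersions are tuples of forms up to scalars, and this
  multiplies all values by \<open>av c\<close>.\<close>

lemma trop_family_in_limit:
  fixes N :: "('k ^ 'n::finite \<Rightarrow> 'k) \<Rightarrow> real"
  assumes N: "N \<in> nontriv_seminorms av"
  shows "trop_family (homothety av `` {N}) \<in> topspace (trop_limit av)"
proof -
  let ?y = "trop_family (homothety av `` {N})"
  have val: "?y (n, linear_map_class n f, U) = trop_coords n (\<lambda>i. N (f i))"
    if "spanning_forms n f" "(n, linear_map_class n f, U) \<in> immersions" for n f U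
    using that by (simp add: seminorm_trop_class[OF N] del: seminorm_trop.simps)
  have "?y i \<in> topspace (Trop av i)" if i_obj: "i \<in> immersions" for i
  proof -
    obtain n f U where i: "i = (n, linear_map_class n f, U)" and f: "spanning_forms n f"
      using i_obj by (rule immersionsE)
    have "trop_coords n (\<lambda>i. N (f i)) \<in> topspace (trop_proj_space n)"
      unfolding topspace_trop_proj_space
      using neg_log_trop_vectors[OF projective_coords_seminorm[OF N f]]
      by (intro image_eqI[of _ _ "\<lambda>i\<in>{..n}. neg_log (N (f i))"]) (auto simp: trop_coords_def trop_point_restrict)
    with trop_of_seminorm[OF N f] val[OF f] i_obj show ?thesis
      by (simp add: i)
  qed
  moreover have "trop_transition j \<sigma> (?y i) = ?y j"
    if i_obj: "i \<in> immersions" and j_obj: "j \<in> immersions" and \<sigma>: "immersion_morphism i j \<sigma>" for i j \<sigma>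
  proof -
    obtain n f U where i: "i = (n, linear_map_class n f, U)" and f: "spanning_forms n f"
      using i_obj by (rule immersionsE)
    obtain n' f' U' where j: "j = (n', linear_map_class n' f', U')" and f': "spanning_forms n' f'"
      using j_obj by (rule immersionsE)
    have \<sigma>_le: "\<sigma> k \<le> n" if "k \<le> n'" for k
      using \<sigma> that by (auto simp: i j)
    have "(\<lambda>k\<in>{..n'}. f (\<sigma> k)) \<in> linear_map_class n' f'"
      using \<sigma> linear_map_class_self[OF f] by (auto simp: i j)
    then obtain c where c: "c \<noteq> 0" "(\<lambda>k\<in>{..n'}. f (\<sigma> k)) = (\<lambda>k\<in>{..n'}. \<lambda>v. c * f' k v)"
      unfolding linear_map_class_def by blast
    have scaled: "N (f (\<sigma> k)) = av c * N (f' k)" if "k \<le> n'" for k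
      using fun_cong[OF c(2), of k] that nontriv_seminormsD(3)[OF N spanning_linear[OF f' that], of c] by simp
    have coords': "projective_coords n' (\<lambda>k. N (f' k))"
      by (rule projective_coords_seminorm[OF N f'])
    then have coords: "projective_coords n' (\<lambda>k. N (f (\<sigma> k)))"
      using av_pos[OF c(1)] by (auto simp: projective_coords_def scaled)
    have "trop_transition j \<sigma> (?y i) = trop_coords n' (\<lambda>k. N (f (\<sigma> k)))"
      using val[OF f] i_obj unfolding i j
      by (simp only: trop_transition_coords[OF projective_coords_seminorm[OF N f] \<sigma>_le coords])
    also have "\<dots> = trop_coords n' (\<lambda>k. N (f' k))"
      by (rule trop_coords_eqI[OF coords' av_pos[OF c(1)] scaled])
    finally show ?thesis
      using val[OF f'] j_obj by (simp only: j)
  qed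
  ultimately show ?thesis
    unfolding trop_limit_def topspace_subtopology topspace_product_topology
    by (intro IntI CollectI ballI allI impI) (auto simp del: Trop.simps seminorm_trop.simps)
qed

lemma openin_limit_preimage:
  fixes i :: "('k, 'n::finite) immersion"
  assumes i: "i = (n, \<iota>, U)" "i \<in> immersions" and A: "openin (trop_proj_space n) A"
  shows "openin (trop_limit av) {y \<in> topspace (trop_limit av). y i \<in> A}"
proof -
  have "continuous_map (trop_limit av) (Trop av i) (\<lambda>y. y i)"
    unfolding trop_limit_def
    using i(2) by (intro continuous_map_from_subtopology continuous_map_product_projection)
  then have "continuous_map (trop_limit av) (trop_proj_space n) (\<lambda>y. y i)"
    by (simp add: i(1) continuous_map_in_subtopology)
  then show ?thesis
    using A by (rule openin_continuous_map_preimage)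
qed

lemma continuous_map_trop_coords:
  fixes f :: "nat \<Rightarrow> 'k ^ 'n::finite \<Rightarrow> 'k"
  assumes f: "spanning_forms n f"
  shows "continuous_map (seminorm_topology av) (trop_proj_space n) (\<lambda>N. trop_coords n (\<lambda>i. N (f i)))"
proof -
  let ?X = "subtopology (product_topology (\<lambda>_. euclidean) {..n}) (trop_vectors n)"
  have "continuous_map (seminorm_topology av) euclidean (\<lambda>N. neg_log (N (f i)))" if "i \<le> n" for i
  proof -
    have "continuous_map (seminorm_topology av) (top_of_set {0..}) (\<lambda>N. N (f i))"
      using spanning_linear[OF f that] nontriv_seminormsD(2)[of _ av "f i"]
      by (auto simp: continuous_map_in_subtopology continuous_map_evaluation topspace_seminorm_topology)
    from continuous_map_compose[OF this, of euclidean neg_log] continuous_on_neg_log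
    show ?thesis by (simp add: o_def)
  qed
  then have "continuous_map (seminorm_topology av) ?X (\<lambda>N. \<lambda>i\<in>{..n}. neg_log (N (f i)))"
    using neg_log_trop_vectors projective_coords_seminorm[OF _ f]
    by (auto simp: continuous_map_in_subtopology continuous_map_componentwise topspace_seminorm_topology)
  moreover have "continuous_map ?X (trop_proj_space n) (trop_point n)"
    unfolding trop_proj_space_def by (rule quotient_imp_continuous_map[OF quotient_map_quot_topology])
  ultimately have "continuous_map (seminorm_topology av) (trop_proj_space n)
      (trop_point n \<circ> (\<lambda>N. \<lambda>i\<in>{..n}. neg_log (N (f i))))"
    by (rule continuous_map_compose)
  then show ?thesis
    by (simp add: o_def trop_coords_def trop_point_restrict)
qed

lemma continuous_map_trop_family:
  "continuous_map (Xbar av :: (('k ^ 'n::finite \<Rightarrow> 'k) \<Rightarrow> real) set topology) (trop_limit av) trop_family"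
proof -
  let ?X = "seminorm_topology av :: (('k ^ 'n \<Rightarrow> 'k) \<Rightarrow> real) topology"
  let ?q = "\<lambda>N. homothety av `` {N}"
  have "continuous_map ?X (Trop av i) (\<lambda>N. trop_family (?q N) i)"
    if i_obj: "i \<in> (immersions :: ('k, 'n) immersion set)" for i
  proof -
    obtain n f U where i: "i = (n, linear_map_class n f, U)" and f: "spanning_forms n f"
      using i_obj by (rule immersionsE)
    have val: "trop_family (?q N) i = trop_coords n (\<lambda>i. N (f i))" if "N \<in> topspace ?X" for N
      using i_obj that seminorm_trop_class[OF _ f]
      by (simp add: i topspace_seminorm_topology del: seminorm_trop.simps)
    have cont: "continuous_map ?X (Trop av i) (\<lambda>N. trop_coords n (\<lambda>i. N (f i)))"
      using continuous_map_trop_coords[OF f] trop_of_seminorm[OF _ f]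
      by (auto simp: i continuous_map_in_subtopology topspace_seminorm_topology)
    show ?thesis
      by (rule continuous_map_eq[OF cont val[symmetric]])
  qed
  then have "continuous_map ?X (product_topology (Trop av) immersions) (\<lambda>N. trop_family (?q N))"
    unfolding continuous_map_componentwise by (intro conjI ballI image_subsetI restrict_extensional)
  moreover have "(\<lambda>N. trop_family (?q N)) ` topspace ?X \<subseteq> topspace (trop_limit av)"
    unfolding topspace_seminorm_topology by (intro image_subsetI trop_family_in_limit)
  ultimately have "continuous_map ?X (trop_limit av) (\<lambda>N. trop_family (?q N))"
    unfolding trop_limit_def continuous_map_in_subtopology topspace_subtopology by blast
  then show ?thesis
    unfolding Xbar_def
    by (intro continuous_compose_quotient_map[OF quotient_map_quot_topology]) (simp add: o_def)
qed

lemma realizes_normalized: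
  fixes N :: "('k ^ 'n::finite \<Rightarrow> 'k) \<Rightarrow> real"
  assumes N: "realizes y linear_forms N" and e: "e \<in> linear_forms" "N e > 0"
  shows "\<exists>N'. realizes y linear_forms N' \<and> N' e = 1"
proof -
  have nt: "N \<in> nontriv_seminorms av" using N by (simp add: realizes_def)
  define N' where "N' = (\<lambda>g\<in>linear_forms. N g / N e)"
  have "N' \<in> nontriv_seminorms av"
    unfolding nontriv_seminorms_def
  proof (intro CollectI conjI ballI allI)
    show "N' g \<ge> 0" if "g \<in> linear_forms" for g
      using that e nontriv_seminormsD(2)[OF nt] by (simp add: N'_def)
    show "N' (\<lambda>v. c * g v) = av c * N' g" if "g \<in> linear_forms" for c g
      using that e nontriv_seminormsD(3)[OF nt] by (simp add: N'_def linear_forms_scale)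
    show "N' (\<lambda>v. g v + h v) \<le> max (N' g) (N' h)" if "g \<in> linear_forms" "h \<in> linear_forms" for g h
      using that e nontriv_seminormsD(4)[OF nt that]
      by (simp add: N'_def linear_forms_add max_def divide_le_cancel split: if_splits)
    show "\<exists>g\<in>linear_forms. N' g \<noteq> 0"
      using e by (intro bexI[of _ e]) (auto simp: N'_def)
  qed (simp add: N'_def)
  moreover have "trop_coords n (\<lambda>i. N' (f i)) = trop_coords n (\<lambda>i. N (f i))" if f: "spanning_forms n f" for n f
    using e spanning_linear[OF f]
    by (intro trop_coords_eqI[of _ _ "1 / N e"] projective_coords_seminorm[OF nt f]) (auto simp: N'_def)
  ultimately have "realizes y linear_forms N'"
    using N by (simp add: realizes_def)
  with e show ?thesis by (auto simp: N'_def)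
qed

text \<open>For a coordinate form \<open>e\<close>, let \<open>D e\<close> be the set of points of the limit whose seminorms do not
  vanish at \<open>e\<close>, and let \<open>s e\<close> send such a point to its seminorm with value \<open>1\<close> at \<open>e\<close>. A condition on the
  value of \<open>s e y\<close> at a form \<open>g\<close> is a condition on a ratio of coordinates of the component of \<open>y\<close> at one
  immersion whose tuple contains \<open>e\<close> and \<open>g\<close>. Hence \<open>D e\<close> is open and the section \<open>s e\<close> is continuous, and
  the image of an open set is the union of its preimages under these sections.\<close>

lemma open_map_trop_family:
  "open_map (Xbar av :: (('k ^ 'n::finite \<Rightarrow> 'k) \<Rightarrow> real) set topology) (trop_limit av) trop_family"
  unfolding open_map_def
proof (intro allI impI)
  let ?L = "trop_limit av :: (('k, 'n) immersion \<Rightarrow> (nat \<Rightarrow> ereal) set) topology"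
  let ?E = "coordinate_forms :: ('k ^ 'n \<Rightarrow> 'k) set"
  fix W :: "(('k ^ 'n \<Rightarrow> 'k) \<Rightarrow> real) set set" assume "openin (Xbar av) W"
  then have W: "openin (seminorm_topology av) {N \<in> nontriv_seminorms av. homothety av `` {N} \<in> W}"
    and W_sub: "W \<subseteq> (\<lambda>N. homothety av `` {N}) ` nontriv_seminorms av"
    by (auto simp: Xbar_def openin_quot_topology topspace_seminorm_topology)
  define normalized where "normalized = (\<lambda>e (y :: ('k, 'n) immersion \<Rightarrow> _) N. realizes y linear_forms N \<and> N e = 1)"
  define D where "D = (\<lambda>e. {y \<in> topspace ?L. \<exists>N. normalized e y N})"
  define s where "s = (\<lambda>e y. SOME N. normalized e y N)"
  have s: "realizes y linear_forms (s e y)" "s e y e = 1" if "y \<in> D e" for e y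
    using that someI_ex[of "normalized e y"] by (auto simp: D_def s_def normalized_def)
  have chart: "openin ?L {y \<in> D e. s e y g \<in> V}"
    if e: "e \<in> ?E" and g: "g \<in> linear_forms" and V: "open V" for e g V
  proof -
    have "finite (insert g ?E)" "insert g ?E \<subseteq> linear_forms"
      using g finite_coordinate_forms coordinate_forms_linear by auto
    then obtain n f where f: "spanning_forms n f" and im: "f ` {..n} = insert g ?E"
      using tuple_of_finite_set by blast
    have "e \<in> f ` {..n}" "g \<in> f ` {..n}" using e by (auto simp: im)
    then obtain i j where ij: "i \<le> n" "e = f i" "j \<le> n" "g = f j" by blast
    let ?i = "(n, linear_map_class n f, proj_points {..n})"
    have sub: "f ` {..n} \<subseteq> linear_forms" using spanning_linear[OF f] by auto
    have val: "y ?i \<in> ratio_set n i j V \<longleftrightarrow> N e \<noteq> 0 \<and> N g / N e \<in> V"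
      if N: "realizes y linear_forms N" for y N
    proof -
      have "N \<in> nontriv_seminorms av" "y ?i = trop_coords n (\<lambda>i. N (f i))"
        using N f sub immersion_full[OF f] unfolding realizes_def by blast+
      then show ?thesis
        using trop_coords_in_ratio_set[OF projective_coords_seminorm[OF _ f] ij(1,3)] by (simp add: ij)
    qed
    have "{y \<in> D e. s e y g \<in> V} = {y \<in> topspace ?L. y ?i \<in> ratio_set n i j V}"
    proof (intro subset_antisym subsetI)
      fix y assume y: "y \<in> {y \<in> D e. s e y g \<in> V}"
      then have yD: "y \<in> D e" by blast
      show "y \<in> {y \<in> topspace ?L. y ?i \<in> ratio_set n i j V}"
        using y val[OF s(1)[OF yD]] s(2)[OF yD] by (simp add: D_def)
    next
      fix y assume y: "y \<in> {y \<in> topspace ?L. y ?i \<in> ratio_set n i j V}"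
      then obtain N where N: "realizes y linear_forms N"
        using realizes_exists by blast
      have e_lin: "e \<in> linear_forms" using e coordinate_forms_linear by auto
      have "N e \<ge> 0"
        using N nontriv_seminormsD(2)[OF _ e_lin] by (auto simp: realizes_def)
      then have "N e > 0" using y val[OF N] by auto
      then have yD: "y \<in> D e"
        using y realizes_normalized[OF N e_lin] by (simp add: D_def normalized_def)
      show "y \<in> {y \<in> D e. s e y g \<in> V}"
        using y yD val[OF s(1)[OF yD]] s(2)[OF yD] by simp
    qed
    then show ?thesis
      using openin_limit_preimage[OF refl immersion_full[OF f] openin_ratio_set[OF ij(1,3) V]] by simp
  qed
  \<comment> \<open>The chart itself is the case of no condition on the value.\<close>
  have D_open: "openin ?L (D e)" if "e \<in> ?E" for e
    using chart[OF that linear_forms_zero open_UNIV] by simp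
  have s_nt: "s e y \<in> nontriv_seminorms av" if "y \<in> D e" for e y
    using s(1)[OF that] by (simp add: realizes_def)
  have s_cont: "continuous_map (subtopology ?L (D e)) (seminorm_topology av) (s e)" if e: "e \<in> ?E" for e
    unfolding seminorm_topology_def
  proof (rule continuous_on_generated_topo)
    have top: "topspace (subtopology ?L (D e)) = D e"
      by (auto simp: D_def)
    fix B :: "(('k ^ 'n \<Rightarrow> 'k) \<Rightarrow> real) set"
    assume "B \<in> {{N \<in> nontriv_seminorms av. N f \<in> V} |f V. f \<in> linear_forms \<and> open V}"
    then obtain g V where B: "B = {N \<in> nontriv_seminorms av. N g \<in> V}" "g \<in> linear_forms" "open V"
      by blast
    have "s e -` B \<inter> topspace (subtopology ?L (D e)) = {y \<in> D e. s e y g \<in> V}"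
      unfolding top by (auto simp: B(1) s_nt)
    then show "openin (subtopology ?L (D e)) (s e -` B \<inter> topspace (subtopology ?L (D e)))"
      using chart[OF e B(2,3)] by (auto simp: openin_open_subtopology[OF D_open[OF e]])
  next
    show "s e ` topspace (subtopology ?L (D e))
        \<subseteq> \<Union> {{N \<in> nontriv_seminorms av. N f \<in> V} |f V. f \<in> linear_forms \<and> open V}"
      unfolding topology_generated_by_topspace[symmetric] seminorm_topology_def[symmetric]
        topspace_seminorm_topology by (auto simp: s_nt)
  qed
  have "openin ?L {y \<in> D e. homothety av `` {s e y} \<in> W}" if e: "e \<in> ?E" for e
  proof -
    have "openin (subtopology ?L (D e)) {y \<in> topspace (subtopology ?L (D e)).
        s e y \<in> {N \<in> nontriv_seminorms av. homothety av `` {N} \<in> W}}"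
      by (rule openin_continuous_map_preimage[OF s_cont[OF e] W])
    also have "{y \<in> topspace (subtopology ?L (D e)).
        s e y \<in> {N \<in> nontriv_seminorms av. homothety av `` {N} \<in> W}}
      = {y \<in> D e. homothety av `` {s e y} \<in> W}"
      by (auto simp: s_nt) (simp add: D_def)
    finally show ?thesis
      by (rule openin_trans_full[OF _ D_open[OF e]])
  qed
  then have "openin ?L (\<Union>e\<in>?E. {y \<in> D e. homothety av `` {s e y} \<in> W})"
    by (intro openin_Union) auto
  also have "(\<Union>e\<in>?E. {y \<in> D e. homothety av `` {s e y} \<in> W}) = trop_family ` W"
  proof (intro subset_antisym subsetI)
    fix y assume "y \<in> (\<Union>e\<in>?E. {y \<in> D e. homothety av `` {s e y} \<in> W})"
    then obtain e where y: "y \<in> D e" "homothety av `` {s e y} \<in> W" by blast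
    have "y = trop_family (homothety av `` {s e y})"
      using y(1) by (intro eq_trop_family s) (auto simp: D_def)
    then show "y \<in> trop_family ` W"
      using y(2) by (rule image_eqI)
  next
    fix y assume "y \<in> trop_family ` W"
    then obtain x where x: "x \<in> W" "y = trop_family x" by (rule imageE)
    then obtain N where nt: "N \<in> nontriv_seminorms av" and x_eq: "x = homothety av `` {N}"
      using W_sub by blast
    have y: "y \<in> topspace ?L" and N: "realizes y linear_forms N"
      unfolding x(2) x_eq by (fact trop_family_in_limit[OF nt] realizes_trop_family[OF nt])+
    obtain e where e: "e \<in> ?E" "N e > 0"
      using seminorm_nonzero_on_coordinates[OF nt] by blast
    have yD: "y \<in> D e"
      using y realizes_normalized[OF N _ e(2)] e(1) coordinate_forms_linear
      by (auto simp: D_def normalized_def)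
    have "homothety av `` {s e y} = x"
      unfolding x_eq by (rule equiv_class_eq[OF homothety_equiv realizes_unique[OF s(1)[OF yD] N]])
    with x(1) e(1) yD show "y \<in> (\<Union>e\<in>?E. {y \<in> D e. homothety av `` {s e y} \<in> W})" by blast
  qed
  finally show "openin ?L (trop_family ` W)" .
qed

end

theorem theorem0p1:
  fixes av :: "'k::field \<Rightarrow> real"
  assumes "complete_nonarch_field av"
  shows "homeomorphic_map
           (Xbar av :: (('k ^ 'n::finite \<Rightarrow> 'k) \<Rightarrow> real) set topology)
           (trop_limit av)
           (\<lambda>x. \<lambda>i\<in>immersions. seminorm_trop i x)"
proof -
  interpret complete_nonarch_field av by (fact assms)
  let ?X = "Xbar av :: (('k ^ 'n::finite \<Rightarrow> 'k) \<Rightarrow> real) set topology"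
  have top: "topspace ?X = (\<lambda>N. homothety av `` {N}) ` nontriv_seminorms av"
    by (simp add: Xbar_def topspace_seminorm_topology)
  have surj: "trop_family ` topspace ?X = topspace (trop_limit av)"
  proof (intro subset_antisym subsetI)
    fix y assume "y \<in> trop_family ` topspace ?X"
    then show "y \<in> topspace (trop_limit av)"
      unfolding top using trop_family_in_limit by blast
  next
    fix y :: "('k, 'n) immersion \<Rightarrow> (nat \<Rightarrow> ereal) set" assume y: "y \<in> topspace (trop_limit av)"
    then obtain N where N: "realizes y linear_forms N"
      using realizes_exists by blast
    then have "N \<in> nontriv_seminorms av" by (simp add: realizes_def)
    then show "y \<in> trop_family ` topspace ?X"
      unfolding top using eq_trop_family[OF y N] by blast
  qed
  have inj: "inj_on trop_family (topspace ?X)"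
  proof (rule inj_onI)
    fix x x' assume "x \<in> topspace ?X" "x' \<in> topspace ?X" and eq: "trop_family x = trop_family x'"
    then obtain N N' where nt: "N \<in> nontriv_seminorms av" "N' \<in> nontriv_seminorms av"
      and x: "x = homothety av `` {N}" "x' = homothety av `` {N'}"
      unfolding top by blast
    have "(N, N') \<in> homothety av"
      using realizes_unique[OF realizes_trop_family[OF nt(1)]] realizes_trop_family[OF nt(2)] eq
      by (simp only: x)
    then show "x = x'"
      unfolding x by (rule equiv_class_eq[OF homothety_equiv])
  qed
  show ?thesis
    by (intro bijective_open_imp_homeomorphic_map continuous_map_trop_family open_map_trop_family surj inj)
qed

end
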